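(* Let $\alpha<0$ and $\vec{a}=(0,0,1)$. Let $\Gamma\subset\mathbb{R}^3_+=\{z>0\}$ be a simple closed convex curve contained in a horizontal plane $\Pi$. If $M$ is a compact $\alpha$-singular minimal surface with boundary $\Gamma$, then $M$ is a graph on $\Pi$. As a consequence, if $\Gamma$ is a circle, then $M$ is a surface of revolution.
   Context: Let $\vec{a}=(0,0,1)$ and $\mathbb{R}^3_+=\{(x,y,z)\in\mathbb{R}^3:z>0\}$. For a real number $\alpha\neq 0$, an $\alpha$-singular minimal surface is a smooth immersion (not assumed to be an embedding) $\phi:M\to\mathbb{R}^3_+$ of an oriented surface $M$ (possibly with smooth boundary) such that $2H=\alpha\,\langle N,\vec{a}\rangle/\langle\phi,\vec{a}\rangle$ on $M$, where $N$ is the Gauss map and $H$ the mean curvature (half the sum of the principal curvatures, with sign such that $\Delta\phi=2HN$ for the Laplace-Beltrami operator of the induced metric). A surface has boundary $\Gamma$ if the restriction of the immersion to $\partial M$ is a diffeomorphism onto $\Gamma$. Horizontal means orthogonal to $\vec{a}$. $M$ is a graph on $\Pi$ if it has the form $\{q+u(q)\vec{a}:q\in D\}$ for a function $u$ on a domain $D\subset\Pi$. *)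

theory Defs
  imports "HOL-Analysis.Analysis"
begin

section \<open>Smooth maps\<close>

text \<open>Meant for open \<open>U\<close>. Derivatives are taken in every fixed direction \<open>v\<close>; since the domain is
  finite-dimensional, this is the usual notion of a \<open>C\<^sup>k\<close> map.\<close>

primrec Ck_on :: "nat \<Rightarrow> 'a::euclidean_space set \<Rightarrow> ('a \<Rightarrow> 'b::real_normed_vector) \<Rightarrow> bool" where
  "Ck_on 0 U f \<longleftrightarrow> continuous_on U f"
| "Ck_on (Suc k) U f \<longleftrightarrow>
     f differentiable_on U \<and> (\<forall>v. Ck_on k U (\<lambda>x. frechet_derivative f (at x) v))"

text \<open>A map on an arbitrary subset of a Euclidean space is smooth if it extends locally to
  a \<open>C\<^sup>\<infinity>\<close> map on an open set. This covers relatively open subsets of a half plane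
  (charts at the boundary) as well as subsets such as curves in space.\<close>

definition smooth_on :: "'a::euclidean_space set \<Rightarrow> ('a \<Rightarrow> 'b::real_normed_vector) \<Rightarrow> bool" where
  "smooth_on S f \<longleftrightarrow>
     (\<forall>x\<in>S. \<exists>U g. open U \<and> x \<in> U \<and> (\<forall>k. Ck_on k U g) \<and> (\<forall>y\<in>S \<inter> U. g y = f y))"


section \<open>Oriented surfaces with boundary\<close>

definition half_plane :: "(real^2) set" where
  "half_plane = {x. 0 \<le> x $ 2}"

text \<open>A chart is a pair \<open>(U, h)\<close> of a domain and a coordinate map.\<close>

definition is_chart :: "'a topology \<Rightarrow> 'a set \<Rightarrow> ('a \<Rightarrow> real^2) \<Rightarrow> bool" where
  "is_chart M U h \<longleftrightarrow>
     openin M U \<and> openin (top_of_set half_plane) (h ` U) \<and>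
     homeomorphic_map (subtopology M U) (top_of_set (h ` U)) h"

text \<open>Derivatives at boundary points are taken within the relatively open subset of the half
  plane on which the map is given; there they are uniquely determined.\<close>

definition oriented_compatible ::
  "'a set \<Rightarrow> ('a \<Rightarrow> real^2) \<Rightarrow> 'a set \<Rightarrow> ('a \<Rightarrow> real^2) \<Rightarrow> bool" where
  "oriented_compatible U1 h1 U2 h2 \<longleftrightarrow>
     (let V = h1 ` (U1 \<inter> U2); T = h2 \<circ> inv_into U1 h1
      in smooth_on V T \<and>
         (\<forall>x\<in>V. 0 < det (matrix (frechet_derivative T (at x within V)))))"

definition oriented_surface :: "'a topology \<Rightarrow> ('a set \<times> ('a \<Rightarrow> real^2)) set \<Rightarrow> bool" where
  "oriented_surface M A \<longleftrightarrow>
     Hausdorff_space M \<and> second_countable M \<and>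
     (\<forall>(U, h)\<in>A. is_chart M U h) \<and>
     (\<Union>(U, h)\<in>A. U) = topspace M \<and>
     (\<forall>(U1, h1)\<in>A. \<forall>(U2, h2)\<in>A. oriented_compatible U1 h1 U2 h2)"

definition surface_boundary :: "'a topology \<Rightarrow> ('a set \<times> ('a \<Rightarrow> real^2)) set \<Rightarrow> 'a set" where
  "surface_boundary M A = {p \<in> topspace M. \<exists>(U, h)\<in>A. p \<in> U \<and> h p $ 2 = 0}"

definition smooth_immersion ::
  "'a topology \<Rightarrow> ('a set \<times> ('a \<Rightarrow> real^2)) set \<Rightarrow> ('a \<Rightarrow> real^3) \<Rightarrow> bool" where
  "smooth_immersion M A \<phi> \<longleftrightarrow>
     (\<forall>(U, h)\<in>A. let V = h ` U; X = \<phi> \<circ> inv_into U h in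
        smooth_on V X \<and> (\<forall>x\<in>V. inj (frechet_derivative X (at x within V))))"

text \<open>The restriction of \<open>\<phi>\<close> to the boundary is a diffeomorphism onto \<open>\<Gamma>\<close>: a homeomorphism which
  is smooth with smooth inverse, both read in the charts of the surface.\<close>

definition has_boundary ::
  "'a topology \<Rightarrow> ('a set \<times> ('a \<Rightarrow> real^2)) set \<Rightarrow> ('a \<Rightarrow> real^3) \<Rightarrow> (real^3) set \<Rightarrow> bool" where
  "has_boundary M A \<phi> \<Gamma> \<longleftrightarrow>
     (let B = surface_boundary M A in
        homeomorphic_map (subtopology M B) (top_of_set \<Gamma>) \<phi> \<and>
        (\<forall>(U, h)\<in>A. smooth_on (h ` (U \<inter> B)) (\<phi> \<circ> inv_into U h) \<and>
                     smooth_on (\<phi> ` (U \<inter> B)) (h \<circ> inv_into B \<phi>)))"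


section \<open>Gauss map and mean curvature of a local parametrization\<close>

definition gauss_map :: "(real^2 \<Rightarrow> real^3) \<Rightarrow> (real^2) set \<Rightarrow> real^2 \<Rightarrow> real^3" where
  "gauss_map X V x =
     (let D = frechet_derivative X (at x within V); n = cross3 (D (axis 1 1)) (D (axis 2 1))
      in n /\<^sub>R norm n)"

text \<open>\<open>k1\<close> and \<open>k2\<close> are the principal curvatures, with multiplicity: there is an orthonormal basis
  of the tangent plane, written as the image of \<open>w1, w2\<close> under the derivative of \<open>X\<close>, which
  consists of eigenvectors of the shape operator \<open>- dN\<close>. With this sign \<open>\<Delta>X = 2 H N\<close>: a sphere
  has positive principal curvatures with respect to its inward normal.\<close>

definition principal_curvatures ::
  "(real^2 \<Rightarrow> real^3) \<Rightarrow> (real^2) set \<Rightarrow> real^2 \<Rightarrow> real \<Rightarrow> real \<Rightarrow> bool" where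
  "principal_curvatures X V x k1 k2 \<longleftrightarrow>
     (let dX = frechet_derivative X (at x within V);
          dN = frechet_derivative (gauss_map X V) (at x within V)
      in \<exists>w1 w2. norm (dX w1) = 1 \<and> norm (dX w2) = 1 \<and> dX w1 \<bullet> dX w2 = 0 \<and>
                 - dN w1 = k1 *\<^sub>R dX w1 \<and> - dN w2 = k2 *\<^sub>R dX w2)"

definition mean_curvature :: "(real^2 \<Rightarrow> real^3) \<Rightarrow> (real^2) set \<Rightarrow> real^2 \<Rightarrow> real" where
  "mean_curvature X V x =
     (THE H. \<exists>k1 k2. principal_curvatures X V x k1 k2 \<and> H = (k1 + k2) / 2)"


section \<open>Singular minimal surfaces\<close>

definition vec_a :: "real^3" where
  "vec_a = vector [0, 0, 1]"

definition upper_half_space :: "(real^3) set" where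
  "upper_half_space = {p. 0 < p $ 3}"

text \<open>Gauss map and mean curvature are invariant under orientation preserving changes of
  parameters, so the equation is stated in every chart of the oriented atlas.\<close>

definition singular_minimal_surface ::
  "real \<Rightarrow> 'a topology \<Rightarrow> ('a set \<times> ('a \<Rightarrow> real^2)) set \<Rightarrow> ('a \<Rightarrow> real^3) \<Rightarrow> bool" where
  "singular_minimal_surface \<alpha> M A \<phi> \<longleftrightarrow>
     \<alpha> \<noteq> 0 \<and> oriented_surface M A \<and> smooth_immersion M A \<phi> \<and>
     \<phi> ` topspace M \<subseteq> upper_half_space \<and>
     (\<forall>(U, h)\<in>A. let V = h ` U; X = \<phi> \<circ> inv_into U h in
        \<forall>x\<in>V. 2 * mean_curvature X V x = \<alpha> * (gauss_map X V x \<bullet> vec_a) / (X x \<bullet> vec_a))"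


section \<open>Planes, curves, graphs, surfaces of revolution\<close>

definition horizontal_plane :: "(real^3) set \<Rightarrow> bool" where
  "horizontal_plane P \<longleftrightarrow> (\<exists>c. P = {p. p \<bullet> vec_a = c})"

definition simple_closed_curve :: "(real^3) set \<Rightarrow> bool" where
  "simple_closed_curve \<Gamma> \<longleftrightarrow>
     (\<exists>g. simple_path g \<and> pathfinish g = pathstart g \<and> path_image g = \<Gamma>)"

text \<open>\<open>\<Gamma>\<close> bounds a convex domain \<open>\<Omega>\<close> of the plane \<open>P\<close>.\<close>

definition convex_curve_in :: "(real^3) set \<Rightarrow> (real^3) set \<Rightarrow> bool" where
  "convex_curve_in P \<Gamma> \<longleftrightarrow>
     (\<exists>\<Omega>. \<Omega> \<noteq> {} \<and> openin (top_of_set P) \<Omega> \<and> bounded \<Omega> \<and> convex \<Omega> \<and> \<Gamma> = closure \<Omega> - \<Omega>)"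

definition circle_in :: "(real^3) set \<Rightarrow> (real^3) set \<Rightarrow> bool" where
  "circle_in P \<Gamma> \<longleftrightarrow> (\<exists>c\<in>P. \<exists>r>0. \<Gamma> = {p \<in> P. dist c p = r})"

text \<open>A domain of the plane, possibly together with some or all of its boundary points (which are
  needed for surfaces with boundary).\<close>

definition domain_in :: "(real^3) set \<Rightarrow> (real^3) set \<Rightarrow> bool" where
  "domain_in P D \<longleftrightarrow>
     D \<subseteq> P \<and>
     (\<exists>\<Omega>. \<Omega> \<noteq> {} \<and> openin (top_of_set P) \<Omega> \<and> connected \<Omega> \<and> \<Omega> \<subseteq> D \<and> D \<subseteq> closure \<Omega>)"

text \<open>For an immersed surface, being a graph includes that the immersion is injective, so that
  the surface may be identified with its image.\<close>

definition graph_on :: "(real^3) set \<Rightarrow> 'a topology \<Rightarrow> ('a \<Rightarrow> real^3) \<Rightarrow> bool" where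
  "graph_on P M \<phi> \<longleftrightarrow>
     inj_on \<phi> (topspace M) \<and>
     (\<exists>D u. domain_in P D \<and> \<phi> ` topspace M = {q + u q *\<^sub>R vec_a | q. q \<in> D})"

text \<open>The rotations about the line through \<open>b\<close> with direction \<open>e\<close> are the maps
  \<open>p \<mapsto> b + Q (p - b)\<close> with \<open>Q\<close> in \<open>SO(3)\<close> fixing \<open>e\<close>.\<close>

definition surface_of_revolution :: "(real^3) set \<Rightarrow> bool" where
  "surface_of_revolution S \<longleftrightarrow>
     (\<exists>b e. e \<noteq> 0 \<and>
        (\<forall>Q::real^3^3. rotation_matrix Q \<and> Q *v e = e \<longrightarrow> (\<lambda>p. b + Q *v (p - b)) ` S = S))"

end

theory Submission
  imports Defs
begin

text \<open>On a singular minimal surface the height \<open>z\<close> satisfies \<open>\<Delta>z = \<alpha> (N \<bullet> a)\<^sup>2 / z\<close>, so for \<open>\<alpha> < 0\<close> it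
  has no interior minimum and the surface lies above the plane of its boundary. A horizontal
  coordinate plus a small multiple of a high power of \<open>z\<close> has no interior maximum, which keeps the
  interior over the convex domain \<open>\<Omega>\<close> and bounds the height over the plane by the distance to the
  boundary. Given two such surfaces, the maximum over pairs of points of the difference of heights
  minus \<open>L\<close> times the smoothed horizontal distance cannot be positive: at an interior pair the
  tangent planes are parallel, and moving both points with the same velocity gives
  \<open>\<alpha> / z \<le> \<alpha> / z'\<close>, that is \<open>z \<le> z'\<close>. Hence the heights of two such surfaces with the same
  boundary agree over equal points of the plane. Comparing the surface with itself shows that it is
  a Lipschitz graph, and comparing it with its rotated copies gives the rotational symmetry.\<close>

section \<open>Curves in a surface and second order conditions\<close>

text \<open>The surface is only immersed, so at the start there is no height function over \<Omega>
  to compare. Doubling the variables avoids this: a maximizing pair exists on compact image sets,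
  and the maximum itself forces the tangent planes to be parallel. This uses only the pointwise
  property \<open>sms_at\<close> of a set, which ignores how many sheets there are, does not change
  when N is replaced by -N, and passes to rotated copies. The smoothing s > 0 keeps the penalty
  differentiable at pairs on one vertical line. The weight L is dictated by the boundary: it is the
  reciprocal of the barrier constant \<kappa>. The sign of \<alpha> matters twice: it makes \<alpha>
  / z increasing in z, which decides interior pairs, and it makes the height pull down the barrier
  function, so the power of z must be high enough, depending on \<alpha>, to compensate. Unique
  heights concern the image alone; two sheets could still cover the same set. This is excluded
  topologically. The Lipschitz bound makes the projection to the plane locally open, so the
  projected double points would form a nonempty compact open subset of the plane.\<close>

definition jet2 :: "(real \<Rightarrow> 'b::real_normed_vector) \<Rightarrow> 'b \<Rightarrow> 'b \<Rightarrow> bool" where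
  "jet2 f v a \<longleftrightarrow> (\<exists>f'. (\<forall>\<^sub>F t in nhds 0. (f has_vector_derivative f' t) (at t)) \<and> f' 0 = v \<and>
     (f' has_vector_derivative a) (at 0))"

lemma jet2_const: "jet2 (\<lambda>t. c) 0 0"
  unfolding jet2_def by (rule exI[of _ "\<lambda>t. 0"]) (auto intro!: derivative_eq_intros)

lemma jet2_diff:
  assumes "jet2 f v a" "jet2 g w b"
  shows "jet2 (\<lambda>t. f t - g t) (v - w) (a - b)"
proof -
  from assms obtain f' g' where
    f: "\<forall>\<^sub>F t in nhds 0. (f has_vector_derivative f' t) (at t)" "f' 0 = v" "(f' has_vector_derivative a) (at 0)" and
    g: "\<forall>\<^sub>F t in nhds 0. (g has_vector_derivative g' t) (at t)" "g' 0 = w" "(g' has_vector_derivative b) (at 0)"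
    unfolding jet2_def by blast
  then show ?thesis
    unfolding jet2_def
  proof (intro exI[of _ "\<lambda>t. f' t - g' t"] conjI)
    show "\<forall>\<^sub>F t in nhds 0. ((\<lambda>t. f t - g t) has_vector_derivative f' t - g' t) (at t)"
      using f(1) g(1) by eventually_elim (rule has_vector_derivative_diff)
  qed (use f g in \<open>auto intro: has_vector_derivative_diff\<close>)
qed

lemma jet2_add:
  assumes "jet2 f v a" "jet2 g w b"
  shows "jet2 (\<lambda>t. f t + g t) (v + w) (a + b)"
proof -
  from assms obtain f' g' where
    f: "\<forall>\<^sub>F t in nhds 0. (f has_vector_derivative f' t) (at t)" "f' 0 = v" "(f' has_vector_derivative a) (at 0)" and
    g: "\<forall>\<^sub>F t in nhds 0. (g has_vector_derivative g' t) (at t)" "g' 0 = w" "(g' has_vector_derivative b) (at 0)"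
    unfolding jet2_def by blast
  then show ?thesis
    unfolding jet2_def
  proof (intro exI[of _ "\<lambda>t. f' t + g' t"] conjI)
    show "\<forall>\<^sub>F t in nhds 0. ((\<lambda>t. f t + g t) has_vector_derivative f' t + g' t) (at t)"
      using f(1) g(1) by eventually_elim (rule has_vector_derivative_add)
  qed (use f g in \<open>auto intro: has_vector_derivative_add\<close>)
qed

lemma jet2_bounded_linear:
  assumes L: "bounded_linear L" and "jet2 f v a"
  shows "jet2 (\<lambda>t. L (f t)) (L v) (L a)"
proof -
  from assms obtain f' where
    "\<forall>\<^sub>F t in nhds 0. (f has_vector_derivative f' t) (at t)" "f' 0 = v" "(f' has_vector_derivative a) (at 0)"
    unfolding jet2_def by blast
  then show ?thesis
    unfolding jet2_def
    by (intro exI[of _ "\<lambda>t. L (f' t)"])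
       (auto elim!: eventually_mono intro!: bounded_linear.has_vector_derivative[OF L])
qed

lemma jet2_inner:
  fixes f g :: "real \<Rightarrow> 'b::real_inner"
  assumes "jet2 f v a" "jet2 g w b"
  shows "jet2 (\<lambda>t. f t \<bullet> g t) (f 0 \<bullet> w + v \<bullet> g 0) (f 0 \<bullet> b + 2 * (v \<bullet> w) + a \<bullet> g 0)"
proof -
  from assms obtain f' g' where
    f: "\<forall>\<^sub>F t in nhds 0. (f has_vector_derivative f' t) (at t)" "f' 0 = v" "(f' has_vector_derivative a) (at 0)" and
    g: "\<forall>\<^sub>F t in nhds 0. (g has_vector_derivative g' t) (at t)" "g' 0 = w" "(g' has_vector_derivative b) (at 0)"
    unfolding jet2_def by blast
  have f0: "(f has_vector_derivative v) (at 0)" and g0: "(g has_vector_derivative w) (at 0)"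
    using f g eventually_nhds_x_imp_x by fastforce+
  note B = bounded_bilinear.has_vector_derivative[OF bounded_bilinear_inner]
  have "((\<lambda>t. f t \<bullet> g' t + f' t \<bullet> g t) has_vector_derivative (f 0 \<bullet> b + v \<bullet> g' 0) + (f' 0 \<bullet> w + a \<bullet> g 0)) (at 0)"
    by (intro has_vector_derivative_add B f0 g0 f g)
  moreover have "\<forall>\<^sub>F t in nhds 0. ((\<lambda>t. f t \<bullet> g t) has_vector_derivative f t \<bullet> g' t + f' t \<bullet> g t) (at t)"
    using f(1) g(1) by eventually_elim (rule B)
  ultimately show ?thesis
    unfolding jet2_def using f(2) g(2)
    by (intro exI[of _ "\<lambda>t. f t \<bullet> g' t + f' t \<bullet> g t"]) (simp add: algebra_simps)
qed

lemma jet2_isCont: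
  assumes "jet2 f v a" shows "isCont f 0"
proof -
  obtain f' where "\<forall>\<^sub>F t in nhds 0. (f has_vector_derivative f' t) (at t)"
    using assms unfolding jet2_def by blast
  then have "(f has_vector_derivative f' 0) (at 0)"
    using eventually_nhds_x_imp_x by fastforce
  then show ?thesis
    using has_vector_derivative_continuous by blast
qed

lemma jet2_compose:
  fixes f :: "real \<Rightarrow> real"
  assumes f: "jet2 f v a"
    and h: "\<forall>\<^sub>F x in nhds (f 0). (h has_real_derivative h' x) (at x)"
           "(h' has_real_derivative h'') (at (f 0))"
  shows "jet2 (\<lambda>t. h (f t)) (h' (f 0) * v) (h'' * v\<^sup>2 + h' (f 0) * a)"
proof -
  from f obtain f' where
    f': "\<forall>\<^sub>F t in nhds 0. (f has_vector_derivative f' t) (at t)" "f' 0 = v" "(f' has_vector_derivative a) (at 0)"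
    unfolding jet2_def by blast
  have f0: "(f has_real_derivative v) (at 0)"
    using f' eventually_nhds_x_imp_x
    unfolding has_real_derivative_iff_has_vector_derivative by fastforce
  have "filterlim f (nhds (f 0)) (nhds 0)"
    using jet2_isCont[OF f] by (simp add: isCont_def tendsto_at_iff_tendsto_nhds)
  then have ev: "\<forall>\<^sub>F t in nhds 0. (h has_real_derivative h' (f t)) (at (f t))"
    using h(1) by (rule eventually_compose_filterlim[rotated])
  have "\<forall>\<^sub>F t in nhds 0. ((\<lambda>t. h (f t)) has_vector_derivative h' (f t) * f' t) (at t)"
    using ev f'(1) unfolding has_real_derivative_iff_has_vector_derivative[symmetric]
    by eventually_elim (rule DERIV_chain2)
  moreover have "((\<lambda>t. h' (f t) * f' t) has_real_derivative (h'' * v) * f' 0 + a * h' (f 0)) (at 0)"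
    using f'(3) unfolding has_real_derivative_iff_has_vector_derivative[symmetric]
    by (intro DERIV_mult DERIV_chain2[OF h(2) f0])
  ultimately show ?thesis
    unfolding jet2_def has_real_derivative_iff_has_vector_derivative using f'(2)
    by (intro exI[of _ "\<lambda>t. h' (f t) * f' t"]) (simp add: power2_eq_square algebra_simps)
qed

text \<open>Since \<open>jet2\<close> gives the second derivative at 0 only, Taylor expansion is
  replaced by this: if \<open>a\<close> were positive, \<open>F'\<close> would be positive just to
  the right of 0, and the mean value theorem would push \<open>F\<close> above
  \<open>F 0\<close>.\<close>

lemma jet2_local_max:
  fixes F :: "real \<Rightarrow> real"
  assumes F: "jet2 F v a" and max: "\<forall>\<^sub>F t in nhds 0. F t \<le> F 0"
  shows "v = 0" "a \<le> 0"
proof -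
  from F obtain F' where
    F': "\<forall>\<^sub>F t in nhds 0. (F has_vector_derivative F' t) (at t)" "F' 0 = v" "(F' has_vector_derivative a) (at 0)"
    unfolding jet2_def by blast
  from F'(1) max have "\<forall>\<^sub>F t in nhds 0. (F has_real_derivative F' t) (at t) \<and> F t \<le> F 0"
    unfolding has_real_derivative_iff_has_vector_derivative by eventually_elim auto
  then obtain d where d: "d > 0" "\<And>t. \<bar>t\<bar> < d \<Longrightarrow> (F has_real_derivative F' t) (at t)"
    "\<And>t. \<bar>t\<bar> < d \<Longrightarrow> F t \<le> F 0"
    unfolding eventually_nhds_metric by (auto simp: dist_real_def)
  have "F' 0 = 0"
    by (rule DERIV_local_max[of F "F' 0" 0 d]) (use d in auto)
  then show v: "v = 0" using F'(2) by simp
  show "a \<le> 0"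
  proof (rule ccontr)
    assume "\<not> a \<le> 0"
    then have "(F' has_real_derivative a) (at 0)" "a > 0"
      using F'(3) by (auto simp: has_real_derivative_iff_has_vector_derivative)
    from DERIV_pos_inc_right[OF this] obtain e where
      e: "e > 0" "\<And>h. 0 < h \<Longrightarrow> h < e \<Longrightarrow> F' 0 < F' (0 + h)" by blast
    define s where "s = min d e / 2"
    have s: "0 < s" "s < d" "s < e" using d e by (auto simp: s_def min_def)
    have "\<exists>z. 0 < z \<and> z < s \<and> F s - F 0 = (s - 0) * F' z"
      by (rule MVT2) (use s d in auto)
    then obtain z where z: "0 < z" "z < s" "F s - F 0 = s * F' z" by auto
    have "F' z > 0" using e(2)[of z] z s F'(2) v by auto
    then have "F s > F 0" using z s by (smt (verit) mult_pos_pos)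
    moreover have "F s \<le> F 0" using d(3)[of s] s by auto
    ultimately show False by simp
  qed
qed

section \<open>Orthonormal frames and the equation in terms of curves\<close>

definition orthonormal_pair :: "real^3 \<Rightarrow> real^3 \<Rightarrow> real^3 \<Rightarrow> bool" where
  "orthonormal_pair N a b \<longleftrightarrow> norm a = 1 \<and> norm b = 1 \<and> a \<bullet> b = 0 \<and> a \<bullet> N = 0 \<and> b \<bullet> N = 0"

lemma orthonormal_pair_exists:
  fixes N :: "real^3"
  assumes "norm N = 1"
  obtains a b where "orthonormal_pair N a b"
proof -
  obtain x where x: "x \<noteq> 0" "orthogonal N x"
    using orthogonal_to_vector_exists[of N] by auto
  define a where "a = x /\<^sub>R norm x"
  have a: "norm a = 1" "a \<bullet> N = 0"
    using x by (auto simp: a_def orthogonal_def inner_commute)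
  have "(norm (cross3 N a))\<^sup>2 = 1"
    using norm_cross_dot[of N a] a assms by (simp add: inner_commute)
  then have "norm (cross3 N a) = 1"
    by (metis norm_ge_zero one_power2 power2_eq_iff_nonneg zero_le_one)
  then have "orthonormal_pair N a (cross3 N a)"
    using a by (simp add: orthonormal_pair_def dot_cross_self)
  then show ?thesis using that by blast
qed

lemma orthonormal_pair_expansion:
  fixes N :: "real^3"
  assumes N: "norm N = 1" and ab: "orthonormal_pair N a b"
  shows "w = (w \<bullet> N) *\<^sub>R N + (w \<bullet> a) *\<^sub>R a + (w \<bullet> b) *\<^sub>R b"
proof -
  let ?B = "{N, a, b}"
  have o: "N \<bullet> N = 1" "a \<bullet> a = 1" "b \<bullet> b = 1" "a \<bullet> b = 0" "b \<bullet> a = 0" "a \<bullet> N = 0" "N \<bullet> a = 0"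
    "b \<bullet> N = 0" "N \<bullet> b = 0"
    using assms by (auto simp: orthonormal_pair_def inner_commute norm_eq_1)
  have d: "N \<noteq> a" "N \<noteq> b" "a \<noteq> b" "0 \<notin> ?B"
    using o by auto
  have "pairwise orthogonal ?B"
    using o by (auto simp: pairwise_def orthogonal_def)
  then have "independent ?B" using d by (intro pairwise_orthogonal_independent) auto
  moreover have "card ?B = DIM(real^3)" using d by simp
  ultimately have sp: "span ?B = UNIV"
    using dim_eq_full dim_eq_card_independent by metis
  define u where "u = w - ((w \<bullet> N) *\<^sub>R N + (w \<bullet> a) *\<^sub>R a + (w \<bullet> b) *\<^sub>R b)"
  have "orthogonal u y" if "y \<in> ?B" for y
    using that o by (auto simp: u_def orthogonal_def inner_simps)
  then have "orthogonal u u"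
    using sp orthogonal_to_span[of u ?B u] by auto
  then have "u = 0" by (simp add: orthogonal_def)
  then show ?thesis by (simp add: u_def)
qed

text \<open>The equation at a point \<open>y\<close> of a subset \<open>S\<close> of space, expressed by curves in \<open>S\<close>: the
  tangential velocities determine the normal parts of the accelerations \<open>acc\<close>, whose trace is
  twice the mean curvature.\<close>

definition sms_at :: "real \<Rightarrow> (real^3) set \<Rightarrow> real^3 \<Rightarrow> bool" where
  "sms_at \<alpha> S y \<longleftrightarrow> (\<exists>N acc. norm N = 1 \<and>
     (\<forall>\<tau>. \<tau> \<bullet> N = 0 \<longrightarrow> (\<exists>\<gamma>. jet2 \<gamma> \<tau> (acc \<tau>) \<and> \<gamma> 0 = y \<and> (\<forall>\<^sub>F t in nhds 0. \<gamma> t \<in> S))) \<and>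
     (\<forall>a b. orthonormal_pair N a b \<longrightarrow> (acc a + acc b) \<bullet> N = \<alpha> * N $ 3 / y $ 3))"

text \<open>At an extremum on the surface the gradient \<open>n\<close> of the test function
  annihilates all tangent vectors. Being then a multiple of \<open>N\<close>, it can be used to test
  the trace condition of \<open>sms_at\<close>.\<close>

lemma normal_multiple:
  fixes N n :: "real^3"
  assumes N: "norm N = 1" and n: "\<And>\<tau>. \<tau> \<bullet> N = 0 \<Longrightarrow> \<tau> \<bullet> n = 0"
  shows "n = (n \<bullet> N) *\<^sub>R N"
proof -
  obtain a b where ab: "orthonormal_pair N a b" using orthonormal_pair_exists[OF N] .
  then have "n \<bullet> a = 0" "n \<bullet> b = 0" using n by (auto simp: orthonormal_pair_def inner_commute)
  then show ?thesis using orthonormal_pair_expansion[OF N ab, of n] by simp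
qed

lemma inner_axis3: "(x::real^3) \<bullet> axis 3 1 = x $ 3" "axis 3 1 \<bullet> x = x $ 3"
  by (simp_all add: inner_axis inner_axis')

lemma bounded_linear_nth3: "bounded_linear (\<lambda>x::real^3. x $ 3)"
  by (rule bounded_linear_vec_nth)

text \<open>At a lowest point the tangent plane is horizontal, so \<open>N $ 3\<close> squares to 1
  and the vertical accelerations have trace \<alpha> / z < 0, whereas a minimum makes each of them
  nonnegative.\<close>

lemma sms_at_not_lowest:
  assumes S: "sms_at \<alpha> S y" and \<alpha>: "\<alpha> < 0" and y: "y $ 3 > 0"
  shows "\<exists>x\<in>S. x $ 3 < y $ 3"
proof (rule ccontr)
  assume "\<not> ?thesis"
  then have min: "y $ 3 \<le> x $ 3" if "x \<in> S" for x using that by force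
  obtain N acc where N: "norm N = 1"
    and cur: "\<And>\<tau>. \<tau> \<bullet> N = 0 \<Longrightarrow> \<exists>\<gamma>. jet2 \<gamma> \<tau> (acc \<tau>) \<and> \<gamma> 0 = y \<and> (\<forall>\<^sub>F t in nhds 0. \<gamma> t \<in> S)"
    and tr: "\<And>a b. orthonormal_pair N a b \<Longrightarrow> (acc a + acc b) \<bullet> N = \<alpha> * N $ 3 / y $ 3"
    using S unfolding sms_at_def by blast
  have 1: "\<tau> $ 3 = 0 \<and> acc \<tau> $ 3 \<ge> 0" if \<tau>N: "\<tau> \<bullet> N = 0" for \<tau>
  proof -
    obtain \<gamma> where \<gamma>: "jet2 \<gamma> \<tau> (acc \<tau>)" "\<gamma> 0 = y" "\<forall>\<^sub>F t in nhds 0. \<gamma> t \<in> S" using cur[OF \<tau>N] by blast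
    have "jet2 (\<lambda>t. - (\<gamma> t $ 3)) (- (\<tau> $ 3)) (- (acc \<tau> $ 3))"
      by (rule jet2_bounded_linear[OF bounded_linear_minus[OF bounded_linear_nth3] \<gamma>(1)])
    moreover have "\<forall>\<^sub>F t in nhds 0. - (\<gamma> t $ 3) \<le> - (\<gamma> 0 $ 3)"
      using \<gamma>(3) by eventually_elim (use min \<gamma>(2) in auto)
    ultimately have "- (\<tau> $ 3) = 0 \<and> - (acc \<tau> $ 3) \<le> 0" by (intro conjI jet2_local_max)
    then show ?thesis by simp
  qed
  obtain a b where ab: "orthonormal_pair N a b" using orthonormal_pair_exists[OF N] .
  have e: "axis 3 1 = (N $ 3) *\<^sub>R N"
    using normal_multiple[OF N, of "axis 3 1"] 1 by (simp add: inner_axis3)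
  have "1 = (N $ 3)\<^sup>2"
    using arg_cong[OF e, of "\<lambda>x. x $ 3"] by (simp add: power2_eq_square)
  moreover have "(acc a + acc b) $ 3 = N $ 3 * (\<alpha> * N $ 3 / y $ 3)"
    using tr[OF ab] arg_cong[OF e, of "\<lambda>x. (acc a + acc b) \<bullet> x"] by (simp add: inner_axis3)
  ultimately have "(acc a + acc b) $ 3 = \<alpha> / y $ 3" by (simp add: power2_eq_square)
  moreover have "(acc a + acc b) $ 3 \<ge> 0"
    using 1[of a] 1[of b] ab by (auto simp: orthonormal_pair_def)
  ultimately show False using \<alpha> y by (smt (verit) divide_neg_pos)
qed

text \<open>Since \<open>\<Delta>\<phi> = 2 H N\<close>, the horizontal coordinate along \<open>v\<close> plus a small multiple of a high
  power of the height is a strict subsolution wherever it is critical.\<close>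

lemma sms_at_barrier_not_max:
  assumes S: "sms_at \<alpha> S y" and \<alpha>: "\<alpha> < 0" and y: "y $ 3 > 0"
    and v: "norm v = 1" "v $ 3 = 0"
    and \<epsilon>: "\<epsilon> > 0" and k: "real k + 1 > - 2 * \<alpha>" and small: "\<epsilon> * real (k + 2) * (y $ 3) ^ (k + 1) \<le> 1"
  shows "\<exists>x\<in>S. x \<bullet> v + \<epsilon> * (x $ 3) ^ (k + 2) > y \<bullet> v + \<epsilon> * (y $ 3) ^ (k + 2)"
proof (rule ccontr)
  assume "\<not> ?thesis"
  then have max: "x \<bullet> v + \<epsilon> * (x $ 3) ^ (k + 2) \<le> y \<bullet> v + \<epsilon> * (y $ 3) ^ (k + 2)" if "x \<in> S" for x
    using that by force
  obtain N acc where N: "norm N = 1"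
    and cur: "\<And>\<tau>. \<tau> \<bullet> N = 0 \<Longrightarrow> \<exists>\<gamma>. jet2 \<gamma> \<tau> (acc \<tau>) \<and> \<gamma> 0 = y \<and> (\<forall>\<^sub>F t in nhds 0. \<gamma> t \<in> S)"
    and tr: "\<And>a b. orthonormal_pair N a b \<Longrightarrow> (acc a + acc b) \<bullet> N = \<alpha> * N $ 3 / y $ 3"
    using S unfolding sms_at_def by blast
  let ?z = "y $ 3"
  \<comment> \<open>\<open>h1\<close> and \<open>h2\<close> are the first and second derivatives of
    \<epsilon> x^(k+2) at the height of \<open>y\<close>, and \<open>n\<close> is the gradient of
    the test function. The assumption \<open>small\<close> says that \<open>h1\<close> is at most
    1.\<close>
  define h1 where "h1 = \<epsilon> * real (k + 2) * ?z ^ (k + 1)"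
  define h2 where "h2 = \<epsilon> * real (k + 2) * real (k + 1) * ?z ^ k"
  define n where "n = v + h1 *\<^sub>R axis 3 1"
  have pow: "((\<lambda>x. e * x ^ m) has_real_derivative e * real m * x ^ (m - 1)) (at x)" for e x :: real and m
    using DERIV_cmult[OF DERIV_pow[of m x], of e] by (simp add: mult.assoc)
  have 1: "\<tau> \<bullet> n = 0 \<and> acc \<tau> \<bullet> n + h2 * (\<tau> $ 3)\<^sup>2 \<le> 0" if \<tau>N: "\<tau> \<bullet> N = 0" for \<tau>
  proof -
    obtain \<gamma> where \<gamma>: "jet2 \<gamma> \<tau> (acc \<tau>)" "\<gamma> 0 = y" "\<forall>\<^sub>F t in nhds 0. \<gamma> t \<in> S" using cur[OF \<tau>N] by blast
    have j3: "jet2 (\<lambda>t. \<gamma> t $ 3) (\<tau> $ 3) (acc \<tau> $ 3)"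
      by (rule jet2_bounded_linear[OF bounded_linear_nth3 \<gamma>(1)])
    have jv: "jet2 (\<lambda>t. \<gamma> t \<bullet> v) (\<tau> \<bullet> v) (acc \<tau> \<bullet> v)"
      by (rule jet2_bounded_linear[OF bounded_linear_inner_left \<gamma>(1)])
    have "jet2 (\<lambda>t. \<epsilon> * (\<gamma> t $ 3) ^ (k + 2)) (\<epsilon> * real (k + 2) * (\<gamma> 0 $ 3) ^ (k + 1) * \<tau> $ 3)
            (h2 * (\<tau> $ 3)\<^sup>2 + \<epsilon> * real (k + 2) * (\<gamma> 0 $ 3) ^ (k + 1) * acc \<tau> $ 3)"
      by (rule jet2_compose[OF j3, where h = "\<lambda>x. \<epsilon> * x ^ (k + 2)" and h' = "\<lambda>x. \<epsilon> * real (k + 2) * x ^ (k + 1)"])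
         (use pow[of \<epsilon> "k + 2"] pow[of "\<epsilon> * real (k + 2)" "k + 1"] in
            \<open>auto intro!: always_eventually simp: h2_def \<gamma>(2)\<close>)
    from jet2_add[OF jv this]
    have "jet2 (\<lambda>t. \<gamma> t \<bullet> v + \<epsilon> * (\<gamma> t $ 3) ^ (k + 2)) (\<tau> \<bullet> n) (acc \<tau> \<bullet> n + h2 * (\<tau> $ 3)\<^sup>2)"
      by (simp add: n_def h1_def \<gamma>(2) inner_simps inner_axis3 algebra_simps)
    moreover have "\<forall>\<^sub>F t in nhds 0. \<gamma> t \<bullet> v + \<epsilon> * (\<gamma> t $ 3) ^ (k + 2) \<le> \<gamma> 0 \<bullet> v + \<epsilon> * (\<gamma> 0 $ 3) ^ (k + 2)"
      using \<gamma>(3) by eventually_elim (use max \<gamma>(2) in auto)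
    ultimately show ?thesis by (intro conjI jet2_local_max)
  qed
  obtain a b where ab: "orthonormal_pair N a b" using orthonormal_pair_exists[OF N] .
  define \<mu> where "\<mu> = n \<bullet> N"
  have n: "n = \<mu> *\<^sub>R N" unfolding \<mu>_def by (rule normal_multiple[OF N]) (use 1 in blast)
  have n3: "n $ 3 = h1" using v by (simp add: n_def axis_def)
  have nn: "n \<bullet> n = 1 + h1\<^sup>2"
    using v by (simp add: n_def inner_simps inner_axis3 power2_eq_square norm_eq_1)
  have "n \<bullet> n = \<mu>\<^sup>2" using N by (simp add: n norm_eq_1 power2_eq_square)
  with nn have \<mu>: "\<mu>\<^sup>2 = 1 + h1\<^sup>2" by simp
  have \<mu>N: "\<mu> * N $ 3 = h1" using n3 by (simp add: n)
  have h1: "0 < h1" "h1 \<le> 1" using \<epsilon> y small by (auto simp: h1_def)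
  \<comment> \<open>The horizontal part of \<open>n\<close> has length 1 and its vertical part is at
    most 1, so the normal is at least 45 degrees away from the vertical. Hence the height has a
    gradient of squared length at least 1/2 along the surface.\<close>
  have "(N $ 3)\<^sup>2 \<le> 1 / 2"
  proof -
    have "\<mu>\<^sup>2 * (N $ 3)\<^sup>2 = h1\<^sup>2" using \<mu>N by (metis power_mult_distrib)
    then have "(1 + h1\<^sup>2) * (N $ 3)\<^sup>2 = h1\<^sup>2" using \<mu> by simp
    moreover have "1 + h1\<^sup>2 > 0" by (simp add: add_pos_nonneg)
    ultimately have "(N $ 3)\<^sup>2 = h1\<^sup>2 / (1 + h1\<^sup>2)" by (simp add: field_simps)
    also have "\<dots> \<le> 1 / 2" using h1 \<open>1 + h1\<^sup>2 > 0\<close> by (simp add: divide_le_eq power_le_one)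
    finally show ?thesis .
  qed
  moreover have "(N $ 3)\<^sup>2 + (a $ 3)\<^sup>2 + (b $ 3)\<^sup>2 = 1"
    using arg_cong[OF orthonormal_pair_expansion[OF N ab, of "axis 3 1"], of "\<lambda>x. x $ 3"]
    by (simp add: inner_axis3 power2_eq_square)
  ultimately have ab3: "(a $ 3)\<^sup>2 + (b $ 3)\<^sup>2 \<ge> 1 / 2" by simp
  have h2: "h2 > 0" using \<epsilon> y by (simp add: h2_def)
  have "(acc a + acc b) \<bullet> n = \<mu> * (\<alpha> * N $ 3 / ?z)"
    using tr[OF ab] by (simp add: n)
  also have "\<dots> = \<alpha> * h1 / ?z" using \<mu>N by (simp add: algebra_simps)
  finally have s: "(acc a + acc b) \<bullet> n = \<alpha> * h1 / ?z" .
  have "a \<bullet> N = 0" "b \<bullet> N = 0" using ab by (auto simp: orthonormal_pair_def)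
  from 1[OF this(1)] 1[OF this(2)] s
  have "\<alpha> * h1 / ?z + h2 * ((a $ 3)\<^sup>2 + (b $ 3)\<^sup>2) \<le> 0" by (simp add: algebra_simps)
  moreover have "h2 * ((a $ 3)\<^sup>2 + (b $ 3)\<^sup>2) \<ge> h2 * (1 / 2)"
    using h2 ab3 by (intro mult_left_mono) auto
  ultimately have "\<alpha> * h1 / ?z + h2 / 2 \<le> 0" by simp
  \<comment> \<open>Both terms carry the same power of z, so the sign depends only on whether (k +
    1) / 2 outweighs -\<alpha>.\<close>
  moreover have "\<alpha> * h1 / ?z + h2 / 2 = \<epsilon> * real (k + 2) * ?z ^ k * (\<alpha> + (real k + 1) / 2)"
    using y by (simp add: h1_def h2_def field_simps)
  moreover have "\<epsilon> * real (k + 2) * ?z ^ k * (\<alpha> + (real k + 1) / 2) > 0"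
    using \<epsilon> y k by (intro mult_pos_pos) (auto simp: field_simps)
  ultimately show False by linarith
qed

section \<open>Barrier and two-point comparison\<close>

definition pr :: "real^3 \<Rightarrow> real^2" where
  "pr y = vector [y $ 1, y $ 2]"

text \<open>Adjoint of \<open>pr\<close> by \<open>inner_lift\<close>: a function of
  \<open>pr y\<close> has as gradient in space the lift of its gradient in the plane.\<close>

definition lift :: "real^2 \<Rightarrow> real^3" where
  "lift q = vector [q $ 1, q $ 2, 0]"

lemma pr_nth [simp]: "pr y $ 1 = y $ 1" "pr y $ 2 = y $ 2"
  by (simp_all add: pr_def)

lemma lift_nth [simp]: "lift q $ 1 = q $ 1" "lift q $ 2 = q $ 2" "lift q $ 3 = 0"
  by (simp_all add: lift_def)

lemma linear_pr: "linear pr"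
  by (rule linearI) (simp_all add: vec_eq_iff forall_2)

lemma bounded_linear_pr: "bounded_linear pr"
  using linear_pr linear_conv_bounded_linear by blast

lemma continuous_on_pr [continuous_intros]:
  "continuous_on A f \<Longrightarrow> continuous_on A (\<lambda>x. pr (f x))"
  by (rule bounded_linear.continuous_on[OF bounded_linear_pr])

lemma inner_lift: "y \<bullet> lift q = pr y \<bullet> q"
  by (simp add: inner_vec_def sum_2 sum_3)

lemma norm_lift: "norm (lift q) = norm q"
  by (simp add: norm_eq_sqrt_inner inner_vec_def sum_2 sum_3)

lemma pr_eqI: "pr x = pr y \<Longrightarrow> x $ 3 = y $ 3 \<Longrightarrow> x = y"
  by (simp add: vec_eq_iff forall_2 forall_3)

text \<open>\<open>n\<close> is the gradient of the test function in the first point, and its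
  negative is the gradient in the second. For equal velocities the horizontal difference has
  velocity 0, so the Hessian of the penalty drops out and only the accelerations tested against
  \<open>n\<close> remain.\<close>

lemma two_point_jet:
  fixes \<gamma> \<gamma>' :: "real \<Rightarrow> real^3"
  assumes g: "jet2 \<gamma> \<tau> a" "jet2 \<gamma>' \<tau>' a'" and s: "s > 0"
    and n: "n = axis 3 1 - (L / sqrt ((norm (pr (\<gamma> 0) - pr (\<gamma>' 0)))\<^sup>2 + s\<^sup>2)) *\<^sub>R lift (pr (\<gamma> 0) - pr (\<gamma>' 0))"
  obtains X where
    "jet2 (\<lambda>t. \<gamma> t $ 3 - \<gamma>' t $ 3 - L * sqrt ((norm (pr (\<gamma> t) - pr (\<gamma>' t)))\<^sup>2 + s\<^sup>2)) (\<tau> \<bullet> n - \<tau>' \<bullet> n) X"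
    "\<tau> = \<tau>' \<Longrightarrow> X = a \<bullet> n - a' \<bullet> n"
proof -
  define d where "d t = pr (\<gamma> t) - pr (\<gamma>' t)" for t
  define G where "G t = d t \<bullet> d t + s\<^sup>2" for t
  define w where "w = pr \<tau> - pr \<tau>'"
  define u where "u = pr a - pr a'"
  define r where "r = sqrt (G 0)"
  \<comment> \<open>The second derivative -1 / (4 r^3) of the root at r^2, in the shape produced by
    the derivative rules.\<close>
  define h2 where "h2 = - (inverse r * (inverse r / 2) * inverse r) / 2"
  have "jet2 d w u"
    unfolding d_def w_def u_def
    by (rule jet2_diff[OF jet2_bounded_linear[OF bounded_linear_pr g(1)] jet2_bounded_linear[OF bounded_linear_pr g(2)]])
  from jet2_add[OF jet2_inner[OF this this] jet2_const[of "s\<^sup>2"]]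
  have G: "jet2 G (2 * (d 0 \<bullet> w)) (2 * (d 0 \<bullet> u) + 2 * (w \<bullet> w))"
    by (simp add: G_def[abs_def] inner_commute)
  have G0: "G 0 > 0" using s by (simp add: G_def add_nonneg_pos)
  have h: "(sqrt has_real_derivative inverse (sqrt x) / 2) (at x)" if "x > 0" for x
    by (rule DERIV_real_sqrt) (use that in auto)
  have "\<forall>\<^sub>F x in nhds (G 0). x > 0"
    by (rule eventually_nhds_in_open[of "{0<..}", simplified]) (use G0 in auto)
  then have h1: "\<forall>\<^sub>F x in nhds (G 0). (sqrt has_real_derivative inverse (sqrt x) / 2) (at x)"
    by eventually_elim (rule h)
  have h2: "((\<lambda>x. inverse (sqrt x) / 2) has_real_derivative h2) (at (G 0))"
    unfolding h2_def r_def
    by (rule DERIV_cdivide, rule DERIV_inverse'[OF h]) (use G0 in auto)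
  have "jet2 (\<lambda>t. - L * sqrt (G t)) (- L * (inverse r / 2 * (2 * (d 0 \<bullet> w))))
          (- L * (h2 * (2 * (d 0 \<bullet> w))\<^sup>2 + inverse r / 2 * (2 * (d 0 \<bullet> u) + 2 * (w \<bullet> w))))"
    using jet2_bounded_linear[OF bounded_linear_mult_right jet2_compose[OF G h1 h2]] unfolding r_def .
  moreover have "jet2 (\<lambda>t. \<gamma> t $ 3 - \<gamma>' t $ 3) (\<tau> $ 3 - \<tau>' $ 3) (a $ 3 - a' $ 3)"
    by (rule jet2_diff[OF jet2_bounded_linear[OF bounded_linear_nth3 g(1)] jet2_bounded_linear[OF bounded_linear_nth3 g(2)]])
  ultimately have J: "jet2 (\<lambda>t. \<gamma> t $ 3 - \<gamma>' t $ 3 + - L * sqrt (G t))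
     ((\<tau> $ 3 - \<tau>' $ 3) + - L * (inverse r / 2 * (2 * (d 0 \<bullet> w))))
     ((a $ 3 - a' $ 3) + - L * (h2 * (2 * (d 0 \<bullet> w))\<^sup>2 + inverse r / 2 * (2 * (d 0 \<bullet> u) + 2 * (w \<bullet> w))))"
    (is "jet2 ?F ?V ?X")
    by (rule jet2_add[rotated])
  have F: "?F = (\<lambda>t. \<gamma> t $ 3 - \<gamma>' t $ 3 - L * sqrt ((norm (pr (\<gamma> t) - pr (\<gamma>' t)))\<^sup>2 + s\<^sup>2))"
    by (simp add: G_def d_def power2_norm_eq_inner)
  have n: "n = axis 3 1 - (L * inverse r) *\<^sub>R lift (d 0)"
    by (simp add: n r_def G_def d_def power2_norm_eq_inner divide_inverse)
  have V: "?V = \<tau> \<bullet> n - \<tau>' \<bullet> n"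
    by (simp add: n w_def inner_diff_right inner_diff_left inner_lift inner_axis3 inner_commute algebra_simps)
  have X: "?X = a \<bullet> n - a' \<bullet> n" if "\<tau> = \<tau>'"
    using that
    by (simp add: n w_def u_def inner_diff_right inner_diff_left inner_lift inner_axis3 inner_commute algebra_simps)
  show ?thesis using that[of ?X] J X unfolding F V by blast
qed

text \<open>At an interior maximum both tangent planes are orthogonal to the same vector, so both points
  may be moved with the same velocity; the penalty then does not contribute to second order.\<close>

lemma sms_at_two_point:
  assumes S: "sms_at \<alpha> S y" and S': "sms_at \<alpha> S' y'" and \<alpha>: "\<alpha> < 0"
    and pos: "y $ 3 > 0" "y' $ 3 > 0" and s: "s > 0"
    and max: "\<And>x x'. x \<in> S \<Longrightarrow> x' \<in> S' \<Longrightarrow>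
      x $ 3 - x' $ 3 - L * sqrt ((norm (pr x - pr x'))\<^sup>2 + s\<^sup>2)
      \<le> y $ 3 - y' $ 3 - L * sqrt ((norm (pr y - pr y'))\<^sup>2 + s\<^sup>2)"
    and mem: "y \<in> S" "y' \<in> S'"
  shows "y $ 3 \<le> y' $ 3"
proof -
  obtain N acc where N: "norm N = 1"
    and cur: "\<And>\<tau>. \<tau> \<bullet> N = 0 \<Longrightarrow> \<exists>\<gamma>. jet2 \<gamma> \<tau> (acc \<tau>) \<and> \<gamma> 0 = y \<and> (\<forall>\<^sub>F t in nhds 0. \<gamma> t \<in> S)"
    and tr: "\<And>a b. orthonormal_pair N a b \<Longrightarrow> (acc a + acc b) \<bullet> N = \<alpha> * N $ 3 / y $ 3"
    using S unfolding sms_at_def by blast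
  obtain N' acc' where N': "norm N' = 1"
    and cur': "\<And>\<tau>. \<tau> \<bullet> N' = 0 \<Longrightarrow> \<exists>\<gamma>. jet2 \<gamma> \<tau> (acc' \<tau>) \<and> \<gamma> 0 = y' \<and> (\<forall>\<^sub>F t in nhds 0. \<gamma> t \<in> S')"
    and tr': "\<And>a b. orthonormal_pair N' a b \<Longrightarrow> (acc' a + acc' b) \<bullet> N' = \<alpha> * N' $ 3 / y' $ 3"
    using S' unfolding sms_at_def by blast
  define n where "n = axis 3 1 - (L / sqrt ((norm (pr y - pr y'))\<^sup>2 + s\<^sup>2)) *\<^sub>R lift (pr y - pr y')"
  have n3: "n $ 3 = 1" by (simp add: n_def)
  have test: "\<tau> \<bullet> n = \<tau>' \<bullet> n \<and> (\<tau> = \<tau>' \<longrightarrow> b \<bullet> n \<le> b' \<bullet> n)"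
    if c: "jet2 \<gamma> \<tau> b" "\<gamma> 0 = y" "\<forall>\<^sub>F t in nhds 0. \<gamma> t \<in> S"
      and c': "jet2 \<gamma>' \<tau>' b'" "\<gamma>' 0 = y'" "\<forall>\<^sub>F t in nhds 0. \<gamma>' t \<in> S'" for \<gamma> \<gamma>' \<tau> \<tau>' b b'
  proof -
    let ?F = "\<lambda>t. \<gamma> t $ 3 - \<gamma>' t $ 3 - L * sqrt ((norm (pr (\<gamma> t) - pr (\<gamma>' t)))\<^sup>2 + s\<^sup>2)"
    obtain X where X: "jet2 ?F (\<tau> \<bullet> n - \<tau>' \<bullet> n) X" "\<tau> = \<tau>' \<Longrightarrow> X = b \<bullet> n - b' \<bullet> n"
      by (rule two_point_jet[OF c(1) c'(1) s, of n L]) (use c(2) c'(2) in \<open>simp_all add: n_def\<close>)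
    have "\<forall>\<^sub>F t in nhds 0. ?F t \<le> ?F 0"
      using c(3) c'(3) by eventually_elim (use max c(2) c'(2) in auto)
    then have "\<tau> \<bullet> n - \<tau>' \<bullet> n = 0" "X \<le> 0" using jet2_local_max X(1) by blast+
    then show ?thesis using X(2) by auto
  qed
  have t: "\<tau> \<bullet> n = 0" if \<tau>N: "\<tau> \<bullet> N = 0" for \<tau>
  proof -
    obtain \<gamma> where "jet2 \<gamma> \<tau> (acc \<tau>)" "\<gamma> 0 = y" "\<forall>\<^sub>F t in nhds 0. \<gamma> t \<in> S" using cur[OF \<tau>N] by blast
    \<comment> \<open>The constant curve at the other point is admissible, which isolates the
      first-order condition at \<open>y\<close>.\<close>
    from test[OF this jet2_const[of y']] mem show ?thesis by simp
  qed
  have t': "\<tau> \<bullet> n = 0" if \<tau>N: "\<tau> \<bullet> N' = 0" for \<tau>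
  proof -
    obtain \<gamma> where "jet2 \<gamma> \<tau> (acc' \<tau>)" "\<gamma> 0 = y'" "\<forall>\<^sub>F t in nhds 0. \<gamma> t \<in> S'" using cur'[OF \<tau>N] by blast
    from test[OF jet2_const[of y] _ _ this] mem show ?thesis by simp
  qed
  define \<mu> where "\<mu> = n \<bullet> N"
  define \<mu>' where "\<mu>' = n \<bullet> N'"
  have n: "n = \<mu> *\<^sub>R N" unfolding \<mu>_def by (rule normal_multiple[OF N t])
  have n': "n = \<mu>' *\<^sub>R N'" unfolding \<mu>'_def by (rule normal_multiple[OF N' t'])
  \<comment> \<open>Because \<open>n $ 3 = 1\<close>, neither factor vanishes: both tangent planes
    equal the plane orthogonal to \<open>n\<close>. The signs of \<open>N\<close> and
    \<open>N'\<close> are absorbed by the factors.\<close>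
  have \<mu>: "\<mu> * N $ 3 = 1" "\<mu>' * N' $ 3 = 1" 
    using arg_cong[OF n, of "\<lambda>x. x $ 3"] arg_cong[OF n', of "\<lambda>x. x $ 3"] n3 by simp_all
  have perp: "\<tau> \<bullet> N' = 0" if "\<tau> \<bullet> N = 0" for \<tau>
    using t[OF that] n' \<mu>(2) by auto
  obtain a b where ab: "orthonormal_pair N a b" using orthonormal_pair_exists[OF N] .
  then have ab': "orthonormal_pair N' a b" using perp by (auto simp: orthonormal_pair_def)
  have acc: "acc \<tau> \<bullet> n \<le> acc' \<tau> \<bullet> n" if \<tau>N: "\<tau> \<bullet> N = 0" for \<tau>
  proof -
    obtain \<gamma> where g: "jet2 \<gamma> \<tau> (acc \<tau>)" "\<gamma> 0 = y" "\<forall>\<^sub>F t in nhds 0. \<gamma> t \<in> S" using cur[OF \<tau>N] by blast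
    obtain \<gamma>' where g': "jet2 \<gamma>' \<tau> (acc' \<tau>)" "\<gamma>' 0 = y'" "\<forall>\<^sub>F t in nhds 0. \<gamma>' t \<in> S'"
      using cur'[OF perp[OF \<tau>N]] by blast
    show ?thesis using test[OF g g'] by simp
  qed
  \<comment> \<open>Testing against \<open>n\<close> instead of \<open>N\<close> turns the
    right-hand side into \<alpha> / z, free of the normal.\<close>
  have "(acc a + acc b) \<bullet> n = \<alpha> * (\<mu> * N $ 3) / y $ 3"
    using tr[OF ab] arg_cong[OF n, of "\<lambda>x. (acc a + acc b) \<bullet> x"] by (simp add: mult.left_commute)
  moreover have "(acc' a + acc' b) \<bullet> n = \<alpha> * (\<mu>' * N' $ 3) / y' $ 3"
    using tr'[OF ab'] arg_cong[OF n', of "\<lambda>x. (acc' a + acc' b) \<bullet> x"] by (simp add: mult.left_commute)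
  moreover have "(acc a + acc b) \<bullet> n \<le> (acc' a + acc' b) \<bullet> n"
    using acc[of a] acc[of b] ab by (simp add: orthonormal_pair_def inner_add_left)
  ultimately have "\<alpha> / y $ 3 \<le> \<alpha> / y' $ 3" using \<mu> by simp
  then show ?thesis using \<alpha> pos
    by (simp add: divide_le_eq le_divide_eq field_simps)
qed

section \<open>Compact sets solving the equation over a convex domain: barrier and
  comparison\<close>

locale convex_boundary =
  fixes \<alpha> c :: real and \<Omega> :: "(real^2) set" and \<Gamma> :: "(real^3) set"
  assumes \<alpha>: "\<alpha> < 0" and c: "c > 0" and \<Gamma>: "\<Gamma> \<noteq> {}" "\<And>b. b \<in> \<Gamma> \<Longrightarrow> b $ 3 = c"
    and \<Gamma>_pr: "\<And>b. b \<in> \<Gamma> \<Longrightarrow> pr b \<in> closure \<Omega> - \<Omega>"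
    and \<Omega>: "convex \<Omega>" "\<Omega> \<noteq> {}"
begin

text \<open>Keeps only the image of a surface: immersion, charts and orientation are gone, so that
  one notion covers the given surface and its rotated copies. The equation is imposed off
  \<open>\<Gamma>\<close> only.\<close>

definition sms_set :: "(real^3) set \<Rightarrow> bool" where
  "sms_set S \<longleftrightarrow> compact S \<and> \<Gamma> \<subseteq> S \<and> (\<forall>y\<in>S. y $ 3 > 0) \<and> (\<forall>y\<in>S - \<Gamma>. sms_at \<alpha> S y)"

lemma sms_set_height:
  assumes S: "sms_set S" and y: "y \<in> S"
  shows "c \<le> y $ 3"
proof -
  have "compact S" "S \<noteq> {}" using S y by (auto simp: sms_set_def)
  moreover have "continuous_on S (\<lambda>y. y $ 3)" by (intro continuous_intros)
  ultimately obtain x where x: "x \<in> S" "\<And>z. z \<in> S \<Longrightarrow> x $ 3 \<le> z $ 3"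
    using continuous_attains_inf[of S "\<lambda>y. y $ 3"] by blast
  have "x \<in> \<Gamma>"
  proof (rule ccontr)
    assume "x \<notin> \<Gamma>"
    with x S have "sms_at \<alpha> S x" "x $ 3 > 0" by (auto simp: sms_set_def)
    then show False using sms_at_not_lowest[OF _ \<alpha>, of S x] x(2) by force
  qed
  then show ?thesis using x(2)[OF y] \<Gamma>(2) by simp
qed

text \<open>Convexity enters the barrier through a line separating \<open>\<Omega>\<close> from
  \<open>q\<close>; passing to the closure extends the inequality to the projected boundary
  curve.\<close>

lemma supporting_direction:
  assumes "q \<notin> \<Omega>"
  obtains v where "norm v = 1" "\<And>b. b \<in> \<Gamma> \<Longrightarrow> pr b \<bullet> v \<le> q \<bullet> v"
proof -
  obtain a b where a: "a \<noteq> 0" "\<forall>x\<in>\<Omega>. a \<bullet> x \<le> b" "b \<le> a \<bullet> q"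
    using separating_hyperplane_sets[of \<Omega> "{q}"] \<Omega> assms by auto
  have cl: "a \<bullet> x \<le> b" if "x \<in> closure \<Omega>" for x
  proof -
    have "closure \<Omega> \<subseteq> {x. a \<bullet> x \<le> b}"
      by (rule closure_minimal) (use a in \<open>auto intro: closed_halfspace_le\<close>)
    then show ?thesis using that by auto
  qed
  show ?thesis
  proof
    show "norm (a /\<^sub>R norm a) = 1" using a by simp
    fix y assume "y \<in> \<Gamma>"
    then have "pr y \<bullet> a \<le> q \<bullet> a" using cl[of "pr y"] \<Gamma>_pr a(3) by (force simp: inner_commute)
    then show "pr y \<bullet> (a /\<^sub>R norm a) \<le> q \<bullet> (a /\<^sub>R norm a)"
      by (simp add: mult_left_mono)
  qed
qed

text \<open>The function x.v + \<epsilon> z^(k+2) takes its maximum on \<open>\<Gamma>\<close>,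
  where z = c and the first term is at most q.v; comparison with its value at \<open>y\<close> gives
  the bound. Neither \<epsilon> nor k depends on v, so \<kappa> serves all \<open>q\<close> at
  once.\<close>

lemma sms_set_barrier:
  assumes S: "sms_set S"
  obtains \<kappa> where "\<kappa> > 0" "\<And>y q. y \<in> S \<Longrightarrow> q \<notin> \<Omega> \<Longrightarrow> \<kappa> * (y $ 3 - c) \<le> norm (pr y - q)"
proof -
  have cpt: "compact S" "S \<noteq> {}" using S \<Gamma> by (auto simp: sms_set_def)
  moreover have "continuous_on S (\<lambda>y. y $ 3)" by (intro continuous_intros)
  ultimately obtain x where x: "x \<in> S" "\<And>z. z \<in> S \<Longrightarrow> z $ 3 \<le> x $ 3"
    using continuous_attains_sup[of S "\<lambda>y. y $ 3"] by blast
  define Z where "Z = x $ 3"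
  have Z: "Z > 0" using x S by (auto simp: Z_def sms_set_def)
  obtain k :: nat where k: "- 2 * \<alpha> < real k" using reals_Archimedean2 by blast
  \<comment> \<open>Normalised so that the derivative \<epsilon> (k + 2) z^(k+1) equals 1 at the
    greatest height \<open>Z\<close> and is at most 1 below it.\<close>
  define \<epsilon> where "\<epsilon> = 1 / (real (k + 2) * Z ^ (k + 1))"
  have \<epsilon>: "\<epsilon> > 0" using Z by (simp add: \<epsilon>_def)
  define \<kappa> where "\<kappa> = \<epsilon> * c ^ (k + 1)"
  show ?thesis
  proof (rule that[of \<kappa>])
    show "\<kappa> > 0" using \<epsilon> c by (simp add: \<kappa>_def)
    fix y q assume y: "y \<in> S" and q: "q \<notin> \<Omega>"
    obtain v where v: "norm v = 1" "\<And>b. b \<in> \<Gamma> \<Longrightarrow> pr b \<bullet> v \<le> q \<bullet> v"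
      using supporting_direction[OF q] by blast
    have cont: "continuous_on S (\<lambda>x. x \<bullet> lift v + \<epsilon> * (x $ 3) ^ (k + 2))" by (intro continuous_intros)
    obtain m where m: "m \<in> S" "\<And>x. x \<in> S \<Longrightarrow>
        x \<bullet> lift v + \<epsilon> * (x $ 3) ^ (k + 2) \<le> m \<bullet> lift v + \<epsilon> * (m $ 3) ^ (k + 2)"
      using continuous_attains_sup[OF cpt cont] by blast
    have m\<Gamma>: "m \<in> \<Gamma>"
    proof (rule ccontr)
      assume "m \<notin> \<Gamma>"
      with m S have sm: "sms_at \<alpha> S m" "m $ 3 > 0" by (auto simp: sms_set_def)
      have "(m $ 3) ^ (k + 1) \<le> Z ^ (k + 1)"
        using x(2)[OF m(1)] sm(2) by (intro power_mono) (auto simp: Z_def)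
      then have "\<epsilon> * real (k + 2) * (m $ 3) ^ (k + 1) \<le> \<epsilon> * real (k + 2) * Z ^ (k + 1)"
        using \<epsilon> by (intro mult_left_mono) auto
      also have "\<dots> = 1" using Z by (simp add: \<epsilon>_def)
      finally show False
        using sms_at_barrier_not_max[OF sm(1) \<alpha> sm(2), of "lift v" \<epsilon> k] m(2) v(1) \<epsilon> k
        by (force simp: norm_lift)
    qed
    \<comment> \<open>Prepares the linear bound z^(k+2) - c^(k+2) \<ge> c^(k+1) (z - c), the origin
      of the second factor of \<kappa>.\<close>
    have "c ^ (k + 1) \<le> (y $ 3) ^ (k + 1)"
      using sms_set_height[OF S y] c by (intro power_mono) auto
    then have "y $ 3 * c ^ (k + 1) \<le> y $ 3 * (y $ 3) ^ (k + 1)"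
      using sms_set_height[OF S y] c by (intro mult_left_mono) auto
    then have "c ^ (k + 1) * (y $ 3 - c) \<le> (y $ 3) ^ (k + 2) - c ^ (k + 2)"
      by (simp add: algebra_simps)
    then have "\<kappa> * (y $ 3 - c) \<le> \<epsilon> * ((y $ 3) ^ (k + 2) - c ^ (k + 2))"
      unfolding \<kappa>_def mult.assoc using \<epsilon> by (intro mult_left_mono) auto
    also have "\<dots> \<le> pr m \<bullet> v - pr y \<bullet> v"
      using m(2)[OF y] \<Gamma>(2)[OF m\<Gamma>] by (simp add: inner_lift algebra_simps)
    also have "\<dots> \<le> (q - pr y) \<bullet> v" using v(2)[OF m\<Gamma>] by (simp add: inner_diff_left)
    also have "\<dots> \<le> norm (q - pr y) * norm v" by (rule norm_cauchy_schwarz)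
    finally show "\<kappa> * (y $ 3 - c) \<le> norm (pr y - q)" using v(1) by (simp add: norm_minus_commute)
  qed
qed

text \<open>A point off \<open>\<Gamma>\<close> is not a lowest one, hence strictly above
  \<open>c\<close>. If it projected outside \<open>\<Omega>\<close>, the barrier with q = pr y would
  have right-hand side 0 and force its height down to \<open>c\<close>.\<close>

lemma sms_set_pr:
  assumes S: "sms_set S" and y: "y \<in> S - \<Gamma>"
  shows "pr y \<in> \<Omega>" "c < y $ 3"
proof -
  have "sms_at \<alpha> S y" "y $ 3 > 0" using S y by (auto simp: sms_set_def)
  then obtain x where "x \<in> S" "x $ 3 < y $ 3" using sms_at_not_lowest[OF _ \<alpha>] by blast
  then show "c < y $ 3" using sms_set_height[OF S] by force
  show "pr y \<in> \<Omega>"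
  proof (rule ccontr)
    assume q: "pr y \<notin> \<Omega>"
    show False
    proof (rule sms_set_barrier[OF S])
      fix \<kappa> :: real
      assume "\<kappa> > 0" and b: "\<And>y q. y \<in> S \<Longrightarrow> q \<notin> \<Omega> \<Longrightarrow> \<kappa> * (y $ 3 - c) \<le> norm (pr y - q)"
      then have "\<kappa> * (y $ 3 - c) \<le> 0" using b[of y "pr y"] y q by simp
      with \<open>c < y $ 3\<close> \<open>\<kappa> > 0\<close> show False by (simp add: mult_le_0_iff)
    qed
  qed
qed

text \<open>At a maximizing pair only the case of \<open>y'\<close> on \<open>\<Gamma>\<close>
  constrains the weight: \<open>pr y'\<close> is then outside \<open>\<Omega>\<close> and the
  barrier shows that L = 1 / \<kappa> suffices. In the other cases \<open>y\<close> is not higher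
  than \<open>y'\<close>. This \<open>L\<close> works for every s, which may then tend to 0.\<close>

lemma sms_set_comparison:
  assumes S: "sms_set S" and S': "sms_set S'"
  obtains L where "L > 0"
    "\<And>y y'. y \<in> S \<Longrightarrow> y' \<in> S' \<Longrightarrow> y $ 3 - y' $ 3 \<le> L * norm (pr y - pr y')"
proof -
  obtain \<kappa> where \<kappa>: "\<kappa> > 0" "\<And>y q. y \<in> S \<Longrightarrow> q \<notin> \<Omega> \<Longrightarrow> \<kappa> * (y $ 3 - c) \<le> norm (pr y - q)"
    using sms_set_barrier[OF S] by blast
  define L where "L = 1 / \<kappa>"
  have L: "L > 0" using \<kappa> by (simp add: L_def)
  have cpt: "compact (S \<times> S')" "S \<times> S' \<noteq> {}"
    using S S' \<Gamma> by (auto simp: sms_set_def intro: compact_Times)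
  have main: "x $ 3 - x' $ 3 \<le> L * sqrt ((norm (pr x - pr x'))\<^sup>2 + s\<^sup>2)"
    if x: "x \<in> S" "x' \<in> S'" and s: "s > 0" for x x' s
  proof -
    let ?F = "\<lambda>x x'. x $ 3 - x' $ 3 - L * sqrt ((norm (pr x - pr x'))\<^sup>2 + s\<^sup>2)"
    have cont: "continuous_on (S \<times> S') (\<lambda>p. ?F (fst p) (snd p))"
      by (intro continuous_intros)
    obtain p where p: "p \<in> S \<times> S'"
      "\<And>z. z \<in> S \<times> S' \<Longrightarrow> ?F (fst z) (snd z) \<le> ?F (fst p) (snd p)"
      using continuous_attains_sup[OF cpt cont] by blast
    obtain y y' where py: "p = (y, y')" by (cases p)
    have y: "y \<in> S" "y' \<in> S'" using p py by auto
    have max: "?F z z' \<le> ?F y y'" if "z \<in> S" "z' \<in> S'" for z z'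
      using p(2)[of "(z, z')"] that py by simp
    have r: "norm (pr y - pr y') \<le> sqrt ((norm (pr y - pr y'))\<^sup>2 + s\<^sup>2)"
      by simp
    have r0: "sqrt ((norm (pr y - pr y'))\<^sup>2 + s\<^sup>2) \<ge> 0" by simp
    have "?F y y' \<le> 0"
    proof (cases "y \<in> \<Gamma> \<or> y' \<in> \<Gamma>")
      case True
      then show ?thesis
      proof
        assume "y \<in> \<Gamma>"
        then have "y $ 3 \<le> y' $ 3" using \<Gamma>(2) sms_set_height[OF S' y(2)] by simp
        then show ?thesis using mult_nonneg_nonneg[of L, OF _ r0] L by linarith
      next
        assume b: "y' \<in> \<Gamma>"
        then have "\<kappa> * (y $ 3 - c) \<le> sqrt ((norm (pr y - pr y'))\<^sup>2 + s\<^sup>2)"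
          using order_trans[OF \<kappa>(2)[OF y(1), of "pr y'"] r] \<Gamma>_pr[OF b] by simp
        then have "y $ 3 - c \<le> L * sqrt ((norm (pr y - pr y'))\<^sup>2 + s\<^sup>2)"
          using \<kappa>(1) by (simp add: L_def field_simps)
        then show ?thesis using \<Gamma>(2)[OF b] by simp
      qed
    next
      case False
      then have "sms_at \<alpha> S y" "sms_at \<alpha> S' y'" "y $ 3 > 0" "y' $ 3 > 0"
        using y S S' by (auto simp: sms_set_def)
      then have "y $ 3 \<le> y' $ 3"
        using sms_at_two_point[OF _ _ \<alpha> _ _ s max y] by blast
      then show ?thesis using mult_nonneg_nonneg[of L, OF _ r0] L by linarith
    qed
    then show ?thesis using max[OF x] by linarith
  qed
  show ?thesis
  proof (rule that[OF L])
    fix y y' assume y: "y \<in> S" "y' \<in> S'"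
    show "y $ 3 - y' $ 3 \<le> L * norm (pr y - pr y')"
    proof (rule field_le_epsilon)
      fix e :: real assume e: "e > 0"
      \<comment> \<open>The root is at most the horizontal distance plus s, so the smoothing costs L
        s = e.\<close>
      define s where "s = e / L"
      have s: "s > 0" using e L by (simp add: s_def)
      have "y $ 3 - y' $ 3 \<le> L * sqrt ((norm (pr y - pr y'))\<^sup>2 + s\<^sup>2)" by (rule main[OF y s])
      also have "\<dots> \<le> L * (norm (pr y - pr y') + s)"
        using L s by (intro mult_left_mono sqrt_sum_squares_le_sum) auto
      also have "\<dots> = L * norm (pr y - pr y') + e" using L by (simp add: s_def field_simps)
      finally show "y $ 3 - y' $ 3 \<le> L * norm (pr y - pr y') + e" .
    qed
  qed
qed

lemma sms_set_unique_height:
  assumes "sms_set S" "sms_set S'" "y \<in> S" "y' \<in> S'" "pr y = pr y'"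
  shows "y = y'"
proof (rule pr_eqI[OF assms(5)])
  have le: "z $ 3 \<le> z' $ 3" if "sms_set T" "sms_set T'" "z \<in> T" "z' \<in> T'" "pr z = pr z'" for T T' z z'
  proof (rule sms_set_comparison[OF that(1,2)])
    fix L assume "\<And>y y'. y \<in> T \<Longrightarrow> y' \<in> T' \<Longrightarrow> y $ 3 - y' $ 3 \<le> L * norm (pr y - pr y')"
    from this[OF that(3,4)] show ?thesis using that(5) by simp
  qed
  show "y $ 3 = y' $ 3"
    by (rule antisym[OF le[OF assms] le[OF assms(2,1,4,3) assms(5)[symmetric]]])
qed

end

section \<open>Gauss map and mean curvature\<close>

text \<open>\<open>mean_curvature\<close> is a definite description, so both existence of principal
  curvatures and uniqueness of their sum are needed. The first is the diagonalisation of a symmetric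
  form in two variables, the second the independence of the trace from the orthonormal
  basis.\<close>

lemma shape_operator_trace:
  fixes D dN :: "real^2 \<Rightarrow> real^3"
  defines "pc k1 k2 \<equiv> (\<exists>w1 w2. norm (D w1) = 1 \<and> norm (D w2) = 1 \<and> D w1 \<bullet> D w2 = 0 \<and>
      - dN w1 = k1 *\<^sub>R D w1 \<and> - dN w2 = k2 *\<^sub>R D w2)"
  assumes D: "linear D" "inj D" and dN: "linear dN" and N: "norm N = 1"
    and perp: "\<And>v. D v \<bullet> N = 0" "\<And>v. dN v \<bullet> N = 0"
    and sym: "\<And>v w. dN v \<bullet> D w = dN w \<bullet> D v"
    and ab: "orthonormal_pair N (D u) (D v)"
  shows "\<exists>k1 k2. pc k1 k2" and "pc k1 k2 \<Longrightarrow> k1 + k2 = - (dN u \<bullet> D u + dN v \<bullet> D v)"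
proof -
  have Dl: "D (r *\<^sub>R x + t *\<^sub>R y) = r *\<^sub>R D x + t *\<^sub>R D y" for r t x y
    using D(1) by (simp add: linear_add linear_scale)
  have Nl: "dN (r *\<^sub>R x + t *\<^sub>R y) = r *\<^sub>R dN x + t *\<^sub>R dN y" for r t x y
    using dN by (simp add: linear_add linear_scale)
  have o: "D u \<bullet> D u = 1" "D v \<bullet> D v = 1" "D u \<bullet> D v = 0" "D v \<bullet> D u = 0"
    using ab by (auto simp: orthonormal_pair_def norm_eq_1 inner_commute)
  show "\<exists>k1 k2. pc k1 k2"
  proof -
    define p where "p = dN u \<bullet> D u"
    define q where "q = dN u \<bullet> D v"
    define s where "s = dN v \<bullet> D v"
    \<comment> \<open>Turning the basis by half the polar angle of (p - s, 2q) makes the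
      off-diagonal entry vanish.\<close>
    obtain r \<theta> where r: "p - s = r * cos \<theta>" "2 * q = r * sin \<theta>" using polar_Ex by blast
    define th where "th = \<theta> / 2"
    have z: "p - s = r * cos (2 * th)" "2 * q = r * sin (2 * th)" using r by (simp_all add: th_def)
    define u1 where "u1 = cos th *\<^sub>R u + sin th *\<^sub>R v"
    define u2 where "u2 = (- sin th) *\<^sub>R u + cos th *\<^sub>R v"
    have cs: "cos th * cos th + sin th * sin th = 1"
      using sin_cos_squared_add[of th] by (simp add: power2_eq_square)
    have "orthonormal_pair N (D u1) (D u2)"
      unfolding orthonormal_pair_def norm_eq_1 using perp(1) cs
      unfolding u1_def u2_def Dl by (simp add: inner_simps o algebra_simps)
    note e = orthonormal_pair_expansion[OF N this]
    have "dN u1 \<bullet> D u2 = (cos th * cos th - sin th * sin th) * q - (cos th * sin th) * (p - s)"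
      using sym[of v u] unfolding u1_def u2_def Nl Dl
      by (simp add: inner_simps p_def q_def s_def algebra_simps)
    also have "\<dots> = (cos (2 * th) * (2 * q) - sin (2 * th) * (p - s)) / 2"
      unfolding cos_double sin_double by (simp add: power2_eq_square field_simps)
    also have "\<dots> = 0" unfolding z by (simp add: algebra_simps)
    finally have 0: "dN u1 \<bullet> D u2 = 0" .
    have 1: "- dN u1 = (- (dN u1 \<bullet> D u1)) *\<^sub>R D u1"
      using e[of "dN u1"] perp(2) 0 by simp
    have 2: "- dN u2 = (- (dN u2 \<bullet> D u2)) *\<^sub>R D u2"
      using e[of "dN u2"] perp(2) 0 sym[of u1 u2] by simp
    show ?thesis
      unfolding pc_def using 1 2 \<open>orthonormal_pair N (D u1) (D u2)\<close>
      unfolding orthonormal_pair_def by blast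
  qed
  show "k1 + k2 = - (dN u \<bullet> D u + dN v \<bullet> D v)" if pc: "pc k1 k2"
  proof -
    obtain w1 w2 where w: "norm (D w1) = 1" "norm (D w2) = 1" "D w1 \<bullet> D w2 = 0"
      "- dN w1 = k1 *\<^sub>R D w1" "- dN w2 = k2 *\<^sub>R D w2"
      using pc unfolding pc_def by blast
    have ow: "orthonormal_pair N (D w1) (D w2)" using w perp by (simp add: orthonormal_pair_def)
    have dw: "dN w1 = (- k1) *\<^sub>R D w1" "dN w2 = (- k2) *\<^sub>R D w2"
      by (simp_all flip: w(4,5))
    \<comment> \<open>The form is diagonal in the basis \<open>D w1\<close>, \<open>D w2\<close>.
      Summed over \<open>D u\<close> and \<open>D v\<close>, the squared coefficients of each
      eigenvector add up to 1.\<close>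
    have q: "dN x \<bullet> D x = - k1 * (D x \<bullet> D w1)\<^sup>2 - k2 * (D x \<bullet> D w2)\<^sup>2" for x
    proof -
      have "D x = D ((D x \<bullet> D w1) *\<^sub>R w1 + (D x \<bullet> D w2) *\<^sub>R w2)"
        using orthonormal_pair_expansion[OF N ow, of "D x"] perp(1) by (simp add: Dl)
      then have "x = (D x \<bullet> D w1) *\<^sub>R w1 + (D x \<bullet> D w2) *\<^sub>R w2"
        using D(2) by (simp add: inj_eq)
      then have "dN x = dN ((D x \<bullet> D w1) *\<^sub>R w1 + (D x \<bullet> D w2) *\<^sub>R w2)"
        by (rule arg_cong)
      then have "dN x = (D x \<bullet> D w1) *\<^sub>R dN w1 + (D x \<bullet> D w2) *\<^sub>R dN w2"
        unfolding Nl .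
      then have "dN x \<bullet> D x = ((D x \<bullet> D w1) *\<^sub>R dN w1 + (D x \<bullet> D w2) *\<^sub>R dN w2) \<bullet> D x"
        by (rule arg_cong)
      then show ?thesis
        by (simp add: dw inner_simps inner_commute power2_eq_square algebra_simps)
    qed
    have s: "(D u \<bullet> D w)\<^sup>2 + (D v \<bullet> D w)\<^sup>2 = 1" if "norm (D w) = 1" for w
      using arg_cong[OF orthonormal_pair_expansion[OF N ab, of "D w"], of "\<lambda>y. y \<bullet> D w"] perp(1) that
      by (simp add: inner_simps norm_eq_1 inner_commute power2_eq_square)
    have "- (dN u \<bullet> D u + dN v \<bullet> D v) = k1 * ((D u \<bullet> D w1)\<^sup>2 + (D v \<bullet> D w1)\<^sup>2)
        + k2 * ((D u \<bullet> D w2)\<^sup>2 + (D v \<bullet> D w2)\<^sup>2)"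
      by (simp add: q algebra_simps)
    then show ?thesis using s[OF w(1)] s[OF w(2)] by simp
  qed
qed

lemma range_eq_orthogonal_plane:
  fixes D :: "real^2 \<Rightarrow> real^3"
  assumes D: "linear D" "inj D" and N: "N \<noteq> 0" and perp: "\<And>v. D v \<bullet> N = 0"
  shows "range D = {y. y \<bullet> N = 0}"
proof -
  have "dim (range D) = 2" using dim_image_eq[OF D(1), of UNIV] D(2) by simp
  moreover have "dim {y. y \<bullet> N = 0} = 2" using dim_hyperplane[OF N] by (simp add: inner_commute)
  ultimately show ?thesis
    using perp D(1)
    by (intro subspace_dim_equal linear_subspace_image subspace_hyperplane2) auto
qed

text \<open>The mean value theorem along \<open>v\<close> turns the second difference into an
  increment of \<open>\<lambda>x. f' x v\<close>, which differentiability at the single point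
  \<open>x0\<close> evaluates. The second difference is symmetric in \<open>v\<close> and
  \<open>w\<close>; the symmetry of second derivatives follows.\<close>

lemma second_difference_estimate:
  fixes f :: "'a::euclidean_space \<Rightarrow> real"
  assumes U: "open U" "x0 \<in> U" and f: "\<And>x. x \<in> U \<Longrightarrow> (f has_derivative f' x) (at x)"
    and h: "((\<lambda>x. f' x v) has_derivative h) (at x0)" and e: "e > 0"
  shows "\<exists>d>0. \<forall>t. 0 < t \<and> t < d \<longrightarrow>
    \<bar>f (x0 + t *\<^sub>R v + t *\<^sub>R w) - f (x0 + t *\<^sub>R v) - f (x0 + t *\<^sub>R w) + f x0 - t\<^sup>2 * h w\<bar> \<le> e * t\<^sup>2"
proof -
  obtain r where r: "r > 0" "ball x0 r \<subseteq> U" using U openE by blast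
  \<comment> \<open>\<open>t * K\<close> bounds all displacements with parameters in [0, t]; the
    summand 1 keeps \<open>K\<close> positive if \<open>v\<close> and \<open>w\<close> vanish. Two
    errors of size e' t K must add up to e t, which fixes e'.\<close>
  define K where "K = norm v + norm w + 1"
  have K: "K > 0" by (simp add: K_def add_nonneg_pos)
  define e' where "e' = e / (2 * K)"
  have e': "e' > 0" using e K by (simp add: e'_def)
  obtain d where d: "d > 0" "\<And>y. norm (y - x0) < d \<Longrightarrow>
      \<bar>f' y v - f' x0 v - h (y - x0)\<bar> \<le> e' * norm (y - x0)"
    using h e' unfolding has_derivative_at_alt by (auto simp: real_norm_def)
  have lin: "linear h" using h has_derivative_linear by blast
  show ?thesis
  proof (intro exI[of _ "min d r / K"] conjI allI impI)
    show "min d r / K > 0" using d r K by simp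
    fix t :: real assume t: "0 < t \<and> t < min d r / K"
    then have tK: "t * K < d" "t * K < r" using K by (simp_all add: field_simps)
    have near: "norm (\<sigma> *\<^sub>R v + \<rho> *\<^sub>R w) \<le> t * K" if "0 \<le> \<sigma>" "\<sigma> \<le> t" "0 \<le> \<rho>" "\<rho> \<le> t" for \<sigma> \<rho>
    proof -
      have "norm (\<sigma> *\<^sub>R v + \<rho> *\<^sub>R w) \<le> \<sigma> * norm v + \<rho> * norm w"
        using norm_triangle_ineq[of "\<sigma> *\<^sub>R v" "\<rho> *\<^sub>R w"] that by simp
      also have "\<dots> \<le> t * norm v + t * norm w"
        using that by (intro add_mono mult_right_mono) auto
      also have "\<dots> \<le> t * K" using t by (simp add: K_def algebra_simps)
      finally show ?thesis .
    qed
    have inU: "x0 + \<sigma> *\<^sub>R v + \<rho> *\<^sub>R w \<in> U" if "0 \<le> \<sigma>" "\<sigma> \<le> t" "0 \<le> \<rho>" "\<rho> \<le> t" for \<sigma> \<rho>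
    proof -
      have "norm (\<sigma> *\<^sub>R v + \<rho> *\<^sub>R w) < r" using near[OF that] tK by linarith
      then have "x0 + (\<sigma> *\<^sub>R v + \<rho> *\<^sub>R w) \<in> ball x0 r" by (metis add_diff_cancel_left' dist_commute dist_norm mem_ball)
      then show ?thesis using r by (auto simp: add.assoc)
    qed
    define \<phi> where "\<phi> \<sigma> = f (x0 + \<sigma> *\<^sub>R v + t *\<^sub>R w) - f (x0 + \<sigma> *\<^sub>R v)" for \<sigma>
    have der: "(\<phi> has_real_derivative f' (x0 + \<sigma> *\<^sub>R v + t *\<^sub>R w) v - f' (x0 + \<sigma> *\<^sub>R v) v) (at \<sigma>)"
      if "0 \<le> \<sigma>" "\<sigma> \<le> t" for \<sigma>
    proof -
      have *: "((\<lambda>\<sigma>. f (x0 + \<sigma> *\<^sub>R v + z)) has_real_derivative f' (x0 + \<sigma> *\<^sub>R v + z) v) (at \<sigma>)"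
        if "x0 + \<sigma> *\<^sub>R v + z \<in> U" for z
      proof -
        have g: "((\<lambda>\<sigma>. x0 + \<sigma> *\<^sub>R v + z) has_derivative (\<lambda>s. s *\<^sub>R v)) (at \<sigma>)"
          by (auto intro!: derivative_eq_intros)
        have "((\<lambda>\<sigma>. f (x0 + \<sigma> *\<^sub>R v + z)) has_derivative (\<lambda>s. f' (x0 + \<sigma> *\<^sub>R v + z) (s *\<^sub>R v))) (at \<sigma>)"
          using has_derivative_compose[OF g f[OF that]] by simp
        moreover have "f' (x0 + \<sigma> *\<^sub>R v + z) (s *\<^sub>R v) = s * f' (x0 + \<sigma> *\<^sub>R v + z) v" for s
          using has_derivative_linear[OF f[OF that]] by (simp add: linear_scale)
        ultimately show ?thesis by (simp add: has_field_derivative_def mult_commute_abs)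
      qed
      show ?thesis unfolding \<phi>_def
        using *[of "t *\<^sub>R w"] *[of 0] inU[OF that, of t] inU[OF that, of 0] t by (auto intro: DERIV_diff)
    qed
    have "\<exists>\<sigma>. 0 < \<sigma> \<and> \<sigma> < t \<and> \<phi> t - \<phi> 0 =
        (t - 0) * (f' (x0 + \<sigma> *\<^sub>R v + t *\<^sub>R w) v - f' (x0 + \<sigma> *\<^sub>R v) v)"
      by (rule MVT2) (use t der in auto)
    then obtain \<sigma> where \<sigma>: "0 < \<sigma>" "\<sigma> < t" "\<phi> t - \<phi> 0 =
        t * (f' (x0 + \<sigma> *\<^sub>R v + t *\<^sub>R w) v - f' (x0 + \<sigma> *\<^sub>R v) v)"
      by auto
    have est: "\<bar>f' (x0 + \<sigma> *\<^sub>R v + \<rho> *\<^sub>R w) v - f' x0 v - h (\<sigma> *\<^sub>R v + \<rho> *\<^sub>R w)\<bar> \<le> e' * (t * K)"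
      if "0 \<le> \<rho>" "\<rho> \<le> t" for \<rho>
    proof -
      have n: "norm (\<sigma> *\<^sub>R v + \<rho> *\<^sub>R w) \<le> t * K" by (rule near) (use \<sigma> that in auto)
      have "\<bar>f' (x0 + \<sigma> *\<^sub>R v + \<rho> *\<^sub>R w) v - f' x0 v - h (\<sigma> *\<^sub>R v + \<rho> *\<^sub>R w)\<bar>
          \<le> e' * norm (\<sigma> *\<^sub>R v + \<rho> *\<^sub>R w)"
        using d(2)[of "x0 + \<sigma> *\<^sub>R v + \<rho> *\<^sub>R w"] n tK by (simp add: add.assoc)
      also have "\<dots> \<le> e' * (t * K)" using e' n by (intro mult_left_mono) auto
      finally show ?thesis .
    qed
    have hh: "h (\<sigma> *\<^sub>R v + t *\<^sub>R w) - h (\<sigma> *\<^sub>R v) = t * h w"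
      using lin by (simp add: linear_add linear_scale)
    have "\<bar>f' (x0 + \<sigma> *\<^sub>R v + t *\<^sub>R w) v - f' (x0 + \<sigma> *\<^sub>R v) v - t * h w\<bar> \<le> e' * (t * K) + e' * (t * K)"
      using est[of t] est[of 0, simplified] t hh by linarith
    also have "\<dots> = e * t" using K by (simp add: e'_def field_simps)
    finally have "t * \<bar>f' (x0 + \<sigma> *\<^sub>R v + t *\<^sub>R w) v - f' (x0 + \<sigma> *\<^sub>R v) v - t * h w\<bar> \<le> t * (e * t)"
      using t by (intro mult_left_mono) auto
    then have "\<bar>t * (f' (x0 + \<sigma> *\<^sub>R v + t *\<^sub>R w) v - f' (x0 + \<sigma> *\<^sub>R v) v) - t\<^sup>2 * h w\<bar> \<le> e * t\<^sup>2"
      using t by (simp add: abs_mult_pos' power2_eq_square algebra_simps)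
    moreover have "f (x0 + t *\<^sub>R v + t *\<^sub>R w) - f (x0 + t *\<^sub>R v) - f (x0 + t *\<^sub>R w) + f x0 = \<phi> t - \<phi> 0"
      by (simp add: \<phi>_def)
    ultimately show "\<bar>f (x0 + t *\<^sub>R v + t *\<^sub>R w) - f (x0 + t *\<^sub>R v) - f (x0 + t *\<^sub>R w) + f x0 - t\<^sup>2 * h w\<bar> \<le> e * t\<^sup>2"
      using \<sigma>(3) by simp
  qed
qed

lemma second_derivative_symmetric_real:
  fixes f :: "'a::euclidean_space \<Rightarrow> real"
  assumes U: "open U" "x0 \<in> U" and f: "\<And>x. x \<in> U \<Longrightarrow> (f has_derivative f' x) (at x)"
    and h: "((\<lambda>x. f' x v) has_derivative h) (at x0)"
    and k: "((\<lambda>x. f' x w) has_derivative k) (at x0)"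
  shows "h w = k v"
proof -
  have "\<bar>h w - k v\<bar> \<le> 0 + e" if e: "e > 0" for e
  proof -
    have e2: "e / 2 > 0" using e by simp
    let ?\<Delta> = "\<lambda>t. f (x0 + t *\<^sub>R v + t *\<^sub>R w) - f (x0 + t *\<^sub>R v) - f (x0 + t *\<^sub>R w) + f x0"
    obtain d where d: "d > 0" "\<And>t. 0 < t \<Longrightarrow> t < d \<Longrightarrow> \<bar>?\<Delta> t - t\<^sup>2 * h w\<bar> \<le> e / 2 * t\<^sup>2"
      using second_difference_estimate[OF U f h e2, of w] by blast
    obtain d' where d': "d' > 0" "\<And>t. 0 < t \<Longrightarrow> t < d' \<Longrightarrow>
        \<bar>f (x0 + t *\<^sub>R w + t *\<^sub>R v) - f (x0 + t *\<^sub>R w) - f (x0 + t *\<^sub>R v) + f x0 - t\<^sup>2 * k v\<bar> \<le> e / 2 * t\<^sup>2"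
      using second_difference_estimate[OF U f k e2, of v] by blast
    define t where "t = min d d' / 2"
    have t: "0 < t" "t < d" "t < d'" using d d' by (auto simp: t_def min_def)
    have "\<bar>?\<Delta> t - t\<^sup>2 * k v\<bar> \<le> e / 2 * t\<^sup>2"
      using d'(2)[OF t(1,3)] by (simp add: algebra_simps)
    with d(2)[OF t(1,2)] have "\<bar>t\<^sup>2 * h w - t\<^sup>2 * k v\<bar> \<le> e * t\<^sup>2" by linarith
    then have "t\<^sup>2 * \<bar>h w - k v\<bar> \<le> t\<^sup>2 * e"
      by (metis abs_mult abs_power2 mult.commute right_diff_distrib)
    then show ?thesis using t by simp
  qed
  then have "\<bar>h w - k v\<bar> \<le> 0" by (rule field_le_epsilon)
  then show ?thesis by simp
qed

lemma second_derivative_symmetric: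
  fixes f :: "'a::euclidean_space \<Rightarrow> 'b::euclidean_space"
  assumes U: "open U" "x0 \<in> U" and f: "\<And>x. x \<in> U \<Longrightarrow> (f has_derivative f' x) (at x)"
    and h: "((\<lambda>x. f' x v) has_derivative h) (at x0)"
    and k: "((\<lambda>x. f' x w) has_derivative k) (at x0)"
  shows "h w = k v"
proof (rule euclidean_eqI)
  fix b :: 'b
  show "h w \<bullet> b = k v \<bullet> b"
    by (rule second_derivative_symmetric_real[OF U, of "\<lambda>x. f x \<bullet> b" "\<lambda>x v. f' x v \<bullet> b"
          v "\<lambda>x. h x \<bullet> b" w "\<lambda>x. k x \<bullet> b"])
       (intro has_derivative_inner_left f h k; assumption)+
qed

section \<open>Passage from charts to the equation along curves\<close>

lemma inner_vec_a: "x \<bullet> vec_a = x $ 3"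
  by (simp add: vec_a_def inner_vec_def sum_3)

lemma bounded_bilinear_cross3: "bounded_bilinear cross3"
  using bilinear_cross bilinear_conv_bounded_bilinear by blast

lemma cross3_nonzero:
  fixes D :: "real^2 \<Rightarrow> real^3"
  assumes "linear D" "inj D"
  shows "cross3 (D (axis 1 1)) (D (axis 2 1)) \<noteq> 0"
proof
  assume 0: "cross3 (D (axis 1 1)) (D (axis 2 1)) = 0"
  have z: "v = 0" if "D v = 0" for v using assms that linear_injective_0 by blast
  from 0 have "collinear {0, D (axis 1 1), D (axis 2 1)}" by (simp add: cross_eq_0)
  then consider "D (axis 1 1) = 0" | "D (axis 2 1) = 0" | k where "D (axis 2 1) = k *\<^sub>R D (axis 1 1)"
    unfolding collinear_lemma by blast
  then show False
  proof cases
    case 1 then show ?thesis using z[of "axis 1 1"] by simp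
  next
    case 2 then show ?thesis using z[of "axis 2 1"] by simp
  next
    case 3
    then have "D (axis 2 1 - k *\<^sub>R axis 1 1) = 0"
      using assms(1) by (simp add: linear_diff linear_scale)
    then have "axis 2 1 - k *\<^sub>R axis 1 1 = (0 :: real^2)" by (rule z)
    then have "(axis 2 1 - k *\<^sub>R axis 1 1 :: real^2) $ 2 = 0" by simp
    then show ?thesis by (simp add: axis_def)
  qed
qed

lemma Ck_on_first:
  assumes "Ck_on (Suc k) U g" "open U" "x \<in> U"
  shows "(g has_derivative frechet_derivative g (at x)) (at x)"
  using assms by (metis Ck_on.simps(2) differentiable_on_eq_differentiable_at frechet_derivative_works)

lemma Ck_on_second:
  assumes "Ck_on (Suc (Suc k)) U g" "open U" "x \<in> U"
  shows "((\<lambda>x. frechet_derivative g (at x) v) has_derivative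
     frechet_derivative (\<lambda>x. frechet_derivative g (at x) v) (at x)) (at x)"
  using assms Ck_on_first[of k U "\<lambda>x. frechet_derivative g (at x) v"] by simp

lemma smooth_on_extension:
  assumes "smooth_on V X" "x0 \<in> V"
  obtains r g where "r > 0" "\<And>k. Ck_on k (ball x0 r) g" "\<And>x. x \<in> V \<inter> ball x0 r \<Longrightarrow> X x = g x"
proof -
  obtain U g where g: "open U" "x0 \<in> U" "\<And>k. Ck_on k U g" "\<And>y. y \<in> V \<inter> U \<Longrightarrow> g y = X y"
    using assms unfolding smooth_on_def by metis
  obtain r where r: "r > 0" "ball x0 r \<subseteq> U" using g openE by blast
  have mono: "Ck_on k T f" if "Ck_on k U f" "T \<subseteq> U" for k T and f :: "'a \<Rightarrow> 'b"
    using that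
    by (induction k arbitrary: f) (auto intro: continuous_on_subset differentiable_on_subset)
  show ?thesis using that[of r g] r g mono by (metis Int_iff subsetD)
qed

text \<open>Images of straight lines through \<open>x0\<close> serve as curves. The normal part of
  their acceleration is the second fundamental form, which the derivative of the Gauss map also
  expresses, so its trace is twice the mean curvature.\<close>

lemma sms_at_parametrization:
  fixes X :: "real^2 \<Rightarrow> real^3"
  assumes sm: "smooth_on V X" and x0: "x0 \<in> interior V"
    and inj: "\<And>x. x \<in> V \<Longrightarrow> inj (frechet_derivative X (at x within V))"
    and H: "2 * mean_curvature X V x0 = \<alpha> * (gauss_map X V x0 \<bullet> vec_a) / (X x0 \<bullet> vec_a)"
    and S: "X ` V \<subseteq> S"
  shows "sms_at \<alpha> S (X x0)"
proof -
  obtain r0 g where r0: "r0 > 0" and Ck: "\<And>k. Ck_on k (ball x0 r0) g"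
    and Xg0: "\<And>x. x \<in> V \<inter> ball x0 r0 \<Longrightarrow> X x = g x"
    using smooth_on_extension[OF sm] x0 interior_subset by (metis subsetD)
  obtain r1 where r1: "r1 > 0" "ball x0 r1 \<subseteq> V" using x0 mem_interior by blast
  define B where "B = ball x0 (min r0 r1)"
  have B: "open B" "x0 \<in> B" "B \<subseteq> V" "B \<subseteq> ball x0 r0" using r0 r1 by (auto simp: B_def)
  \<comment> \<open>At interior points derivatives within \<open>V\<close> are ordinary ones, so
    \<open>X\<close> may be replaced by its smooth extension \<open>g\<close> near
    \<open>x0\<close>.\<close>
  have BV: "at x within V = at x" if "x \<in> B" for x
    using B that by (meson at_within_interior interior_maximal subsetD)
  have Xg: "X x = g x" if "x \<in> B" for x using Xg0[of x] B that by blast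
  define D where "D x = frechet_derivative g (at x)" for x
  define D2 where "D2 v = frechet_derivative (\<lambda>x. D x v) (at x0)" for v
  have gD: "(g has_derivative D x) (at x)" if "x \<in> B" for x
    unfolding D_def using Ck_on_first[OF Ck[of "Suc 0"], of x] B that by auto
  have DD2: "((\<lambda>x. D x v) has_derivative D2 v) (at x0)" for v
    unfolding D_def D2_def using Ck_on_second[OF Ck[of "Suc (Suc 0)"], of x0] B by auto
  have XD: "frechet_derivative X (at x within V) = D x" if "x \<in> B" for x
  proof -
    have "(X has_derivative D x) (at x)"
      by (rule has_derivative_transform_within_open[OF gD[OF that] B(1) that]) (simp add: Xg)
    then show ?thesis using BV[OF that] frechet_derivative_at by metis
  qed
  have lin: "linear (D x)" if "x \<in> B" for x using gD[OF that] has_derivative_linear by blast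
  have injD: "inj (D x)" if "x \<in> B" for x using inj[of x] XD[OF that] B that by auto
  have D2lin: "linear (D2 v)" for v using DD2 has_derivative_linear by blast
  have D2sym: "D2 v w = D2 w v" for v w
    by (rule second_derivative_symmetric[OF B(1,2) gD DD2 DD2])
  define m where "m x = cross3 (D x (axis 1 1)) (D x (axis 2 1))" for x
  define G where "G x = m x /\<^sub>R norm (m x)" for x
  have m0: "m x \<noteq> 0" if "x \<in> B" for x
    unfolding m_def by (rule cross3_nonzero[OF lin[OF that] injD[OF that]])
  have GX: "gauss_map X V x = G x" if "x \<in> B" for x
    by (simp add: gauss_map_def XD[OF that] G_def m_def Let_def)
  have "m differentiable at x0"
    unfolding m_def[abs_def]
    using bounded_bilinear.FDERIV[OF bounded_bilinear_cross3 DD2 DD2] by (auto simp: differentiable_def)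
  moreover from this have "(\<lambda>x. norm (m x)) differentiable at x0"
    using differentiable_compose[of norm m x0 UNIV] differentiable_norm_at[OF m0[OF B(2)]]
    by simp
  ultimately have "G differentiable at x0"
    unfolding G_def[abs_def] using m0[OF B(2)] by (intro differentiable_scaleR differentiable_inverse) auto
  define dN where "dN = frechet_derivative G (at x0)"
  have dG: "(G has_derivative dN) (at x0)"
    using \<open>G differentiable at x0\<close> unfolding dN_def frechet_derivative_works .
  have "(gauss_map X V has_derivative dN) (at x0)"
    by (rule has_derivative_transform_within_open[OF dG B(1,2)]) (simp add: GX)
  then have dNX: "frechet_derivative (gauss_map X V) (at x0 within V) = dN"
    using BV[OF B(2)] frechet_derivative_at by metis
  have zero: "h = (\<lambda>v. 0)" if "(f has_derivative h) (at x0)" "\<And>x. x \<in> B \<Longrightarrow> f x = c" for f :: "real^2 \<Rightarrow> real" and h c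
  proof -
    have "((\<lambda>x. c) has_derivative h) (at x0)"
      by (rule has_derivative_transform_within_open[OF that(1) B(1,2)]) (simp add: that(2))
    then show ?thesis using has_derivative_unique[OF _ has_derivative_const] by blast
  qed
  have GD0: "G x \<bullet> D x v = 0" if "x \<in> B" for x v
  proof -
    have v: "v = v $ 1 *\<^sub>R axis 1 1 + v $ 2 *\<^sub>R axis 2 1"
      by (simp add: vec_eq_iff forall_2 axis_def)
    have "D x v = v $ 1 *\<^sub>R D x (axis 1 1) + v $ 2 *\<^sub>R D x (axis 2 1)"
      by (subst v) (use lin[OF that] in \<open>simp add: linear_add linear_scale\<close>)
    then show ?thesis by (simp add: G_def m_def inner_simps dot_cross_self)
  qed
  have GG: "G x \<bullet> G x = 1" if "x \<in> B" for x
    using m0[OF that] by (simp add: G_def dot_square_norm power2_eq_square field_simps)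
  define N where "N = G x0"
  have N: "norm N = 1" using GG[OF B(2)] by (simp add: N_def norm_eq_1)
  \<comment> \<open>Obtained by differentiating the orthogonality of \<open>G\<close> and
    \<open>D v\<close> in direction \<open>w\<close>; together with \<open>D2sym\<close> it makes
    the shape operator symmetric.\<close>
  have II: "N \<bullet> D2 v w = - (dN w \<bullet> D x0 v)" for v w
    using fun_cong[OF zero[OF has_derivative_inner[OF dG DD2[of v]] GD0], of w]
    by (simp add: N_def)
  have dNN: "dN w \<bullet> N = 0" for w
    using fun_cong[OF zero[OF has_derivative_inner[OF dG dG] GG], of w]
    by (simp add: N_def inner_commute)
  have DN: "D x0 v \<bullet> N = 0" for v using GD0[OF B(2)] by (simp add: N_def inner_commute)
  have sym: "dN v \<bullet> D x0 w = dN w \<bullet> D x0 v" for v w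
    using II[of v w] II[of w v] D2sym[of v w] by simp
  have dNlin: "linear dN" using dG has_derivative_linear by blast
  \<comment> \<open>A right inverse of \<open>D x0\<close> on the tangent plane, since the range of
    \<open>D x0\<close> is the whole plane orthogonal to \<open>N\<close>.\<close>
  define W where "W = inv (D x0)"
  have "range (D x0) = {y. y \<bullet> N = 0}"
    by (rule range_eq_orthogonal_plane[OF lin[OF B(2)] injD[OF B(2)]]) (use N DN in auto)
  then have DW: "D x0 (W \<tau>) = \<tau>" if "\<tau> \<bullet> N = 0" for \<tau>
    unfolding W_def using that by (intro f_inv_into_f) auto
  define acc where "acc \<tau> = D2 (W \<tau>) (W \<tau>)" for \<tau>
  have curve: "\<exists>\<gamma>. jet2 \<gamma> \<tau> (acc \<tau>) \<and> \<gamma> 0 = X x0 \<and> (\<forall>\<^sub>F t in nhds 0. \<gamma> t \<in> S)" if "\<tau> \<bullet> N = 0" for \<tau>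
  proof (intro exI conjI)
    define w where "w = W \<tau>"
    define l where "l t = x0 + t *\<^sub>R w" for t
    have l: "(l has_derivative (\<lambda>s. s *\<^sub>R w)) (at t)" for t
      unfolding l_def by (auto intro!: derivative_eq_intros)
    have l0: "l 0 = x0" by (simp add: l_def)
    have "isCont l 0" unfolding l_def by (intro continuous_intros)
    then have "filterlim l (nhds x0) (nhds 0)"
      using l0 tendsto_at_iff_tendsto_nhds[of l 0] by (simp add: isCont_def)
    then have "\<forall>\<^sub>F t in nhds 0. l t \<in> B"
      by (rule eventually_compose_filterlim[OF eventually_nhds_in_open[OF B(1,2)]])
    have "\<forall>\<^sub>F t in nhds 0. ((\<lambda>t. g (l t)) has_vector_derivative D (l t) w) (at t)"
      using \<open>\<forall>\<^sub>F t in nhds 0. l t \<in> B\<close>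
    proof eventually_elim
      case (elim t)
      have "((\<lambda>t. g (l t)) has_derivative (\<lambda>s. D (l t) (s *\<^sub>R w))) (at t)"
        by (rule has_derivative_compose[OF l gD[OF elim]])
      then show ?case using lin[OF elim] by (simp add: has_vector_derivative_def linear_scale)
    qed
    moreover have "((\<lambda>t. D (l t) w) has_vector_derivative D2 w w) (at 0)"
    proof -
      have "((\<lambda>t. D (l t) w) has_derivative (\<lambda>s. D2 w (s *\<^sub>R w))) (at 0)"
        by (rule has_derivative_compose[OF l]) (simp add: l0 DD2)
      then show ?thesis using D2lin by (simp add: has_vector_derivative_def linear_scale)
    qed
    ultimately show "jet2 (\<lambda>t. g (l t)) \<tau> (acc \<tau>)"
      unfolding jet2_def using DW[OF that]
      by (intro exI[of _ "\<lambda>t. D (l t) w"]) (simp add: l0 w_def acc_def)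
    show "g (l 0) = X x0" using Xg[OF B(2)] by (simp add: l0)
    show "\<forall>\<^sub>F t in nhds 0. g (l t) \<in> S"
      using \<open>\<forall>\<^sub>F t in nhds 0. l t \<in> B\<close>
    proof eventually_elim
      case (elim t)
      then show ?case using Xg[OF elim] S B(3) by (metis image_subset_iff subsetD)
    qed
  qed
  have trace: "(acc a + acc b) \<bullet> N = \<alpha> * N $ 3 / X x0 $ 3" if ab: "orthonormal_pair N a b" for a b
  proof -
    have DWab: "D x0 (W a) = a" "D x0 (W b) = b" using ab DW by (auto simp: orthonormal_pair_def)
    let ?T = "- (dN (W a) \<bullet> a + dN (W b) \<bullet> b)"
    have pc: "principal_curvatures X V x0 k1 k2 \<longleftrightarrow>
       (\<exists>w1 w2. norm (D x0 w1) = 1 \<and> norm (D x0 w2) = 1 \<and> D x0 w1 \<bullet> D x0 w2 = 0 \<and>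
      - dN w1 = k1 *\<^sub>R D x0 w1 \<and> - dN w2 = k2 *\<^sub>R D x0 w2)" for k1 k2
      unfolding principal_curvatures_def XD[OF B(2)] dNX Let_def ..
    have ab': "orthonormal_pair N (D x0 (W a)) (D x0 (W b))" using ab DWab by simp
    note tr = shape_operator_trace[OF lin[OF B(2)] injD[OF B(2)] dNlin N DN dNN sym ab', folded pc, unfolded DWab]
    have mc: "mean_curvature X V x0 = ?T / 2"
      unfolding mean_curvature_def
    proof (rule the_equality)
      show "\<exists>k1 k2. principal_curvatures X V x0 k1 k2 \<and> ?T / 2 = (k1 + k2) / 2"
        using tr by metis
    qed (use tr(2) in auto)
    have "(acc a + acc b) \<bullet> N = ?T"
      using II[of "W a" "W a"] II[of "W b" "W b"] DWab by (simp add: acc_def inner_simps inner_commute)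
    also have "\<dots> = 2 * mean_curvature X V x0" unfolding mc by simp
    also have "\<dots> = \<alpha> * N $ 3 / X x0 $ 3"
      using H GX[OF B(2)] by (simp add: N_def inner_vec_a)
    finally show ?thesis .
  qed
  show ?thesis
    unfolding sms_at_def using N curve trace by blast
qed

section \<open>Topology of the immersed surface\<close>

lemma smooth_on_imp_continuous_on:
  assumes "smooth_on V X"
  shows "continuous_on V X"
proof -
  have "continuous (at x within V) X" if x: "x \<in> V" for x
  proof -
    obtain r g where r: "r > 0" "\<And>k. Ck_on k (ball x r) g" "\<And>y. y \<in> V \<inter> ball x r \<Longrightarrow> X y = g y"
      using smooth_on_extension[OF assms x] by blast
    have "continuous_on (ball x r) g" using r(2)[of 0] by simp
    then have "isCont g x" using r(1) by (simp add: continuous_on_eq_continuous_at)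
    then have "continuous (at x within V) g" by (rule continuous_at_imp_continuous_at_within)
    then show ?thesis
      by (rule continuous_transform_within[OF _ r(1) x]) (use r(3) in \<open>auto simp: dist_commute\<close>)
  qed
  then show ?thesis by (simp add: continuous_on_eq_continuous_within)
qed

text \<open>On the edge of the half plane the derivative within \<open>V\<close> is still unique,
  because small steps in the positive coordinate directions stay in \<open>V\<close>. Thus
  injectivity of the derivative transfers to a smooth extension across the edge.\<close>

lemma half_plane_derivative_extension:
  fixes X :: "real^2 \<Rightarrow> 'b::real_normed_vector"
  assumes V: "openin (top_of_set half_plane) V" and x0: "x0 \<in> V"
    and X: "\<And>x. x \<in> V \<inter> ball x0 r \<Longrightarrow> X x = g x" and r: "r > 0"
    and g: "(g has_derivative g') (at x0)"
  shows "(X has_derivative g') (at x0 within V)" "frechet_derivative X (at x0 within V) = g'"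
proof -
  have "(g has_derivative g') (at x0 within V)" using g by (rule has_derivative_at_withinI)
  then show *: "(X has_derivative g') (at x0 within V)"
    by (rule has_derivative_transform_within[OF _ r x0]) (use X in \<open>auto simp: dist_commute\<close>)
  then have **: "(X has_derivative frechet_derivative X (at x0 within V)) (at x0 within V)"
    using differentiableI frechet_derivative_works by blast
  show "frechet_derivative X (at x0 within V) = g'"
  proof (rule frechet_derivative_unique_within[OF ** *])
    fix i :: "real^2" and e :: real assume i: "i \<in> Basis" and e: "e > 0"
    obtain T where T: "open T" "V = half_plane \<inter> T" using V by (auto simp: openin_open)
    then obtain s where s: "s > 0" "ball x0 s \<subseteq> T" using x0 openE by blast
    define d where "d = min e s / 2"
    have d: "0 < d" "d < e" "d < s" using e s by (auto simp: d_def min_def)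
    have "i $ 2 \<ge> 0" using i by (auto simp: Basis_vec_def axis_def)
    then have "x0 + d *\<^sub>R i \<in> half_plane" using x0 T d by (simp add: half_plane_def)
    moreover have "x0 + d *\<^sub>R i \<in> ball x0 s" using i d by (simp add: dist_norm norm_Basis)
    ultimately show "\<exists>d. 0 < \<bar>d\<bar> \<and> \<bar>d\<bar> < e \<and> x0 + d *\<^sub>R i \<in> V"
      using d s T by (intro exI[of _ d]) auto
  qed
qed

text \<open>\<open>Ck_on\<close> supplies continuity of the derivative in each fixed direction; the
  sum over a basis upgrades it to the operator norm, as needed for local injectivity.\<close>

lemma C1_immersion_locally_injective:
  fixes g :: "'a::euclidean_space \<Rightarrow> 'b::euclidean_space"
  assumes g: "Ck_on (Suc (Suc 0)) (ball x0 r) g" and r: "r > 0"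
    and inj: "inj (frechet_derivative g (at x0))"
  obtains s where "s > 0" "s \<le> r" "inj_on g (ball x0 s)"
proof -
  define D where "D x = frechet_derivative g (at x)" for x
  have der: "(g has_derivative D x) (at x)" if "x \<in> ball x0 r" for x
    unfolding D_def by (rule Ck_on_first[OF g _ that]) simp
  have bl: "bounded_linear (D x)" if "x \<in> ball x0 r" for x
    using der[OF that] has_derivative_bounded_linear by blast
  have "linear (D x0)" using bl[of x0] r by (simp add: bounded_linear.linear)
  then obtain g' where g': "linear g'" "g' \<circ> D x0 = id"
    using linear_injective_left_inverse[of "D x0"] inj unfolding D_def by blast
  have cont: "isCont (\<lambda>x. D x v) x0" for v
    using Ck_on_second[OF g, of x0 v] r has_derivative_continuous unfolding D_def by auto
  have "\<exists>d>0. \<forall>x. dist x0 x < d \<longrightarrow> onorm (\<lambda>v. D x v - D x0 v) < e" if e: "e > 0" for e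
  proof -
    let ?f = "\<lambda>x. \<Sum>b\<in>Basis. norm (D x b - D x0 b)"
    have "isCont ?f x0" by (intro continuous_intros cont)
    then have "\<exists>d>0. \<forall>x. dist x x0 < d \<longrightarrow> dist (?f x) (?f x0) < e"
      using e unfolding continuous_at_eps_delta by blast
    then obtain d where d: "d > 0" "\<And>x. dist x x0 < d \<Longrightarrow> dist (?f x) (?f x0) < e" by blast
    show ?thesis
    proof (intro exI[of _ "min d r"] conjI allI impI)
      show "min d r > 0" using d r by simp
      fix x assume x: "dist x0 x < min d r"
      then have "onorm (\<lambda>v. D x v - D x0 v) \<le> ?f x"
        using bl[of x] bl[of x0] r by (intro onorm_componentwise bounded_linear_sub) auto
      also have "\<dots> < e" using d(2)[of x] x by (simp add: dist_commute dist_real_def)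
      finally show "onorm (\<lambda>v. D x v - D x0 v) < e" .
    qed
  qed
  then obtain s where "s > 0" "ball x0 s \<subseteq> ball x0 r" "inj_on g (ball x0 s)"
    using has_derivative_locally_injective[of x0 "ball x0 r" g' D g] g' r der
    by (auto simp: linear_conv_bounded_linear)
  then have "inj_on g (ball x0 (min s r))" by (auto intro: inj_on_subset)
  then show ?thesis using that[of "min s r"] r \<open>s > 0\<close> by simp
qed

lemma chart_facts:
  assumes "is_chart M U h"
  shows "openin M U" "openin (top_of_set half_plane) (h ` U)" "inj_on h U"
    "continuous_map (subtopology M U) (top_of_set (h ` U)) h"
    "\<And>W. openin M W \<Longrightarrow> openin (top_of_set half_plane) (h ` (U \<inter> W))"
    "\<And>T. open T \<Longrightarrow> openin M {p \<in> U. h p \<in> T}"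
proof -
  show U: "openin M U" and V: "openin (top_of_set half_plane) (h ` U)"
    using assms by (auto simp: is_chart_def)
  have top: "topspace (subtopology M U) = U"
    using openin_subset[OF U] by (simp add: Int_absorb1)
  have hom: "homeomorphic_map (subtopology M U) (top_of_set (h ` U)) h"
    using assms by (auto simp: is_chart_def)
  show "inj_on h U" using homeomorphic_imp_injective_map[OF hom] top by simp
  show cont: "continuous_map (subtopology M U) (top_of_set (h ` U)) h"
    using homeomorphic_imp_continuous_map[OF hom] .
  show "openin (top_of_set half_plane) (h ` (U \<inter> W))" if "openin M W" for W
  proof -
    have "openin (subtopology M U) (U \<inter> W)" using that by (simp add: openin_subtopology_Int2)
    then have "openin (top_of_set (h ` U)) (h ` (U \<inter> W))"
      using homeomorphic_imp_open_map[OF hom] by (simp add: open_map_def)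
    then show ?thesis using V openin_trans by blast
  qed
  show "openin M {p \<in> U. h p \<in> T}" if "open T" for T
  proof -
    have "openin (top_of_set (h ` U)) (h ` U \<inter> T)" using that by (simp add: openin_open_Int)
    then have "openin (subtopology M U) {p \<in> topspace (subtopology M U). h p \<in> h ` U \<inter> T}"
      using cont openin_continuous_map_preimage by blast
    moreover have "{p \<in> topspace (subtopology M U). h p \<in> h ` U \<inter> T} = {p \<in> U. h p \<in> T}"
      using top by auto
    ultimately show ?thesis using openin_open_subtopology[OF U] by simp
  qed
qed

lemma half_plane_interior:
  assumes "openin (top_of_set half_plane) V" "x \<in> V" "x $ 2 > 0"
  shows "x \<in> interior V"
proof -
  obtain T where T: "open T" "V = half_plane \<inter> T" using assms by (auto simp: openin_open)
  have "open (T \<inter> {x. x $ 2 > 0})"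
    using T(1) by (intro open_Int open_Collect_less continuous_intros)
  moreover have "T \<inter> {x. x $ 2 > 0} \<subseteq> V" using T by (auto simp: half_plane_def)
  ultimately show ?thesis using assms T by (intro interiorI[of "T \<inter> {x. x $ 2 > 0}"]) auto
qed

section \<open>Global structure of the compact surface\<close>

locale compact_sms = convex_boundary +
  fixes M :: "'a topology" and A :: "('a set \<times> ('a \<Rightarrow> real^2)) set" and \<phi> :: "'a \<Rightarrow> real^3"
  assumes sms: "singular_minimal_surface \<alpha> M A \<phi>" and compact_M: "compact_space M"
    and boundary: "has_boundary M A \<phi> \<Gamma>" and \<Omega>_open: "open \<Omega>"
begin

abbreviation "S \<equiv> \<phi> ` topspace M"
abbreviation "B \<equiv> surface_boundary M A"

lemma Hausdorff_M: "Hausdorff_space M"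
  using sms by (simp add: singular_minimal_surface_def oriented_surface_def)

lemma chart:
  assumes "p \<in> topspace M"
  obtains U h where "(U, h) \<in> A" "p \<in> U"
proof -
  have "(\<Union>(U, h)\<in>A. U) = topspace M"
    using sms by (simp add: singular_minimal_surface_def oriented_surface_def)
  then show ?thesis using assms that by blast
qed

lemma chartD:
  assumes "(U, h) \<in> A"
  shows "is_chart M U h" "U \<subseteq> topspace M" "smooth_on (h ` U) (\<phi> \<circ> inv_into U h)"
    "\<And>x. x \<in> h ` U \<Longrightarrow> inj (frechet_derivative (\<phi> \<circ> inv_into U h) (at x within h ` U))"
    "\<And>p. p \<in> U \<Longrightarrow> (\<phi> \<circ> inv_into U h) (h p) = \<phi> p"
    "\<And>p. p \<in> U \<Longrightarrow> h p $ 2 \<ge> 0"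
proof -
  show c: "is_chart M U h"
    using sms assms by (auto simp: singular_minimal_surface_def oriented_surface_def)
  show "U \<subseteq> topspace M" using chart_facts(1)[OF c] openin_subset by blast
  have *: "let V = h ` U; X = \<phi> \<circ> inv_into U h in
        smooth_on V X \<and> (\<forall>x\<in>V. inj (frechet_derivative X (at x within V)))"
    using sms assms unfolding singular_minimal_surface_def smooth_immersion_def by blast
  show "smooth_on (h ` U) (\<phi> \<circ> inv_into U h)" using * by (simp add: Let_def)
  show "inj (frechet_derivative (\<phi> \<circ> inv_into U h) (at x within h ` U))" if "x \<in> h ` U" for x
    using * that unfolding Let_def by blast
  show "(\<phi> \<circ> inv_into U h) (h p) = \<phi> p" if "p \<in> U" for p
    using chart_facts(3)[OF c] that by simp
  have "h ` U \<subseteq> half_plane" using chart_facts(2)[OF c] openin_imp_subset by blast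
  then show "h p $ 2 \<ge> 0" if "p \<in> U" for p using that by (auto simp: half_plane_def)
qed

lemma continuous_\<phi>: "continuous_map M euclidean \<phi>"
proof (rule pasting_lemma[where I = A and T = fst and f = "\<lambda>_. \<phi>"])
  fix i assume i: "i \<in> A"
  obtain U h where Uh: "i = (U, h)" by (cases i)
  note ch = chartD[OF i[unfolded Uh]]
  note cf = chart_facts[OF ch(1)]
  show "openin M (fst i)" using cf(1) Uh by simp
  have "continuous_map (top_of_set (h ` U)) euclidean (\<phi> \<circ> inv_into U h)"
    using smooth_on_imp_continuous_on[OF ch(3)] by simp
  from continuous_map_compose[OF cf(4) this]
  have "continuous_map (subtopology M U) euclidean (\<phi> \<circ> inv_into U h \<circ> h)" .
  from continuous_map_eq[OF this, of \<phi>] ch(5)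
  show "continuous_map (subtopology M (fst i)) euclidean \<phi>" by (simp add: Uh)
next
  fix x assume "x \<in> topspace M"
  then show "\<exists>j. j \<in> A \<and> x \<in> fst j \<and> \<phi> x = \<phi> x" using chart by (metis fst_conv)
qed auto

lemma boundary_bij: "B \<subseteq> topspace M" "\<phi> ` B = \<Gamma>" "inj_on \<phi> B"
proof -
  show B: "B \<subseteq> topspace M" by (auto simp: surface_boundary_def)
  have hom: "homeomorphic_map (subtopology M B) (top_of_set \<Gamma>) \<phi>"
    using boundary by (auto simp: has_boundary_def Let_def)
  have top: "topspace (subtopology M B) = B" using B by (simp add: Int_absorb1)
  show "\<phi> ` B = \<Gamma>" using homeomorphic_imp_surjective_map[OF hom] top by simp
  show "inj_on \<phi> B" using homeomorphic_imp_injective_map[OF hom] top by simp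
qed

lemma positive_height: "y \<in> S \<Longrightarrow> y $ 3 > 0"
  using sms by (auto simp: singular_minimal_surface_def upper_half_space_def)

lemma sms_at_interior:
  assumes Uh: "(U, h) \<in> A" and p: "p \<in> U" "h p $ 2 > 0"
  shows "sms_at \<alpha> S (\<phi> p)"
proof -
  note ch = chartD[OF Uh]
  let ?X = "\<phi> \<circ> inv_into U h"
  have "h p \<in> interior (h ` U)"
    using half_plane_interior[OF chart_facts(2)[OF ch(1)]] p by blast
  moreover have "2 * mean_curvature ?X (h ` U) (h p) =
      \<alpha> * (gauss_map ?X (h ` U) (h p) \<bullet> vec_a) / (?X (h p) \<bullet> vec_a)"
  proof -
    have "\<forall>(U, h)\<in>A. let V = h ` U; X = \<phi> \<circ> inv_into U h in
        \<forall>x\<in>V. 2 * mean_curvature X V x = \<alpha> * (gauss_map X V x \<bullet> vec_a) / (X x \<bullet> vec_a)"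
      using sms unfolding singular_minimal_surface_def by blast
    from this[rule_format, OF Uh] show ?thesis using p by (simp add: Let_def)
  qed
  moreover have "?X ` h ` U \<subseteq> S" using ch(2,5) by (auto simp: image_comp)
  ultimately have "sms_at \<alpha> S (?X (h p))" by (intro sms_at_parametrization[OF ch(3) _ ch(4)])
  then show ?thesis using ch(5)[OF p(1)] by simp
qed

lemma interior_chart:
  assumes p: "p \<in> topspace M - B"
  obtains U h where "(U, h) \<in> A" "p \<in> U" "h p $ 2 > 0"
proof -
  obtain U h where Uh: "(U, h) \<in> A" "p \<in> U" using chart p by blast
  moreover have "h p $ 2 \<noteq> 0" using Uh p by (auto simp: surface_boundary_def)
  ultimately show ?thesis using that[OF Uh] chartD(6)[OF Uh] by simp
qed

lemma sms_set_S: "sms_set S"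
  unfolding sms_set_def
proof (intro conjI ballI)
  have "compactin euclidean S"
    using image_compactin[OF _ continuous_\<phi>] compact_M by (simp add: compact_space_def)
  then show "compact S" by simp
  show "\<Gamma> \<subseteq> S" using boundary_bij by blast
  show "y $ 3 > 0" if "y \<in> S" for y by (rule positive_height[OF that])
  fix y assume "y \<in> S - \<Gamma>"
  then obtain p where "p \<in> topspace M - B" "y = \<phi> p" using boundary_bij by blast
  then show "sms_at \<alpha> S y" using interior_chart sms_at_interior by metis
qed

text \<open>Phrased by a chart instead of \<open>p \<notin> B\<close>: membership in
  \<open>B\<close> asks for some chart with vanishing second coordinate, which positivity in another
  chart does not exclude at once. The strict height does, as it keeps \<open>\<phi> p\<close> off
  \<open>\<Gamma>\<close>.\<close>

lemma height_interior:
  assumes "(U, h) \<in> A" "p \<in> U" "h p $ 2 > 0"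
  shows "\<phi> p $ 3 > c"
proof -
  have "\<phi> p \<in> S" using chartD(2)[OF assms(1)] assms(2) by blast
  then have "\<phi> p $ 3 > 0" by (rule positive_height)
  then obtain y where "y \<in> S" "y $ 3 < \<phi> p $ 3"
    using sms_at_not_lowest[OF sms_at_interior[OF assms] \<alpha>] by blast
  then show ?thesis using sms_set_height[OF sms_set_S] by force
qed

lemma boundary_iff:
  assumes "p \<in> topspace M"
  shows "p \<in> B \<longleftrightarrow> \<phi> p \<in> \<Gamma>"
proof
  assume "\<phi> p \<in> \<Gamma>"
  show "p \<in> B"
  proof (rule ccontr)
    assume "p \<notin> B"
    then obtain U h where "(U, h) \<in> A" "p \<in> U" "h p $ 2 > 0" using interior_chart assms by blast
    from height_interior[OF this] \<Gamma>(2)[OF \<open>\<phi> p \<in> \<Gamma>\<close>] show False by simp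
  qed
qed (use boundary_bij in blast)

text \<open>Rules out the empty alternative when connectedness of \<open>\<Omega>\<close> is
  applied. From any point of the surface, a small step into the half plane of a chart reaches the
  interior.\<close>

lemma interior_nonempty: "S - \<Gamma> \<noteq> {}"
proof -
  obtain p where p: "p \<in> topspace M" using \<Gamma>(1) boundary_bij by blast
  obtain U h where Uh: "(U, h) \<in> A" "p \<in> U" using chart[OF p] by blast
  note ch = chartD[OF Uh(1)]
  obtain T where T: "open T" "h ` U = half_plane \<inter> T"
    using chart_facts(2)[OF ch(1)] by (auto simp: openin_open)
  then obtain s where s: "s > 0" "ball (h p) s \<subseteq> T" using Uh openE by blast
  define x where "x = h p + (s / 2) *\<^sub>R axis 2 1"
  have x2: "x $ 2 > 0" using ch(6)[OF Uh(2)] s by (simp add: x_def)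
  have "x \<in> ball (h p) s" using s by (simp add: x_def dist_norm)
  then have "x \<in> h ` U" using s T x2 by (auto simp: half_plane_def)
  then obtain q where q: "q \<in> U" "x = h q" by blast
  then have "\<phi> q $ 3 > c" using height_interior[OF Uh(1) q(1)] x2 by simp
  moreover have "\<phi> q \<in> S" using q ch(2) by blast
  ultimately show ?thesis using \<Gamma>(2) by force
qed

text \<open>Covers boundary points too, since the extension across the edge is injective on a full
  ball. It keeps double points of \<open>\<phi>\<close> away from the diagonal.\<close>

lemma locally_injective:
  assumes "p \<in> topspace M"
  obtains W where "openin M W" "p \<in> W" "inj_on \<phi> W"
proof -
  obtain U h where Uh: "(U, h) \<in> A" "p \<in> U" using chart[OF assms] by blast
  define X where "X = \<phi> \<circ> inv_into U h"
  note ch = chartD[OF Uh(1), folded X_def]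
  note cf = chart_facts[OF ch(1)]
  have x0: "h p \<in> h ` U" using Uh by blast
  obtain r g where r: "r > 0" "\<And>k. Ck_on k (ball (h p) r) g"
    "\<And>x. x \<in> h ` U \<inter> ball (h p) r \<Longrightarrow> X x = g x"
    using smooth_on_extension[OF ch(3) x0] by blast
  have "(g has_derivative frechet_derivative g (at (h p))) (at (h p))"
    using Ck_on_first[OF r(2)[of "Suc 0"], of "h p"] r(1) by simp
  from half_plane_derivative_extension(2)[OF cf(2) x0 r(3) r(1) this] ch(4)[OF x0]
  have "inj (frechet_derivative g (at (h p)))" by simp
  then obtain s where s: "s > 0" "s \<le> r" "inj_on g (ball (h p) s)"
    using C1_immersion_locally_injective[OF r(2) r(1)] by blast
  show ?thesis
  proof
    show "openin M {q \<in> U. h q \<in> ball (h p) s}" by (rule cf(6)) simp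
    show "p \<in> {q \<in> U. h q \<in> ball (h p) s}" using Uh s by simp
    have "\<phi> q = g (h q)" if "q \<in> U" "h q \<in> ball (h p) s" for q
      using r(3)[of "h q"] ch(5)[OF that(1)] that s(2) by auto
    then show "inj_on \<phi> {q \<in> U. h q \<in> ball (h p) s}"
      using s(3) cf(3) by (auto simp: inj_on_def)
  qed
qed

text \<open>The comparison of the surface with itself is a Lipschitz estimate for the height, which
  excludes vertical tangent vectors.\<close>

lemma nonvertical:
  fixes X :: "real^2 \<Rightarrow> real^3"
  assumes x0: "x0 \<in> interior V" and X: "(X has_derivative D) (at x0)" and D: "inj D"
    and V: "X ` V \<subseteq> S"
  shows "inj (\<lambda>w. pr (D w))"
proof -
  obtain L where L: "L > 0"
    "\<And>y y'. y \<in> S \<Longrightarrow> y' \<in> S \<Longrightarrow> y $ 3 - y' $ 3 \<le> L * norm (pr y - pr y')"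
    using sms_set_comparison[OF sms_set_S sms_set_S] by blast
  have lin: "linear D" using X has_derivative_linear by blast
  have "w = 0" if w: "pr (D w) = 0" for w
  proof -
    define l where "l t = x0 + t *\<^sub>R w" for t
    have l: "(l has_derivative (\<lambda>s. s *\<^sub>R w)) (at 0)"
      unfolding l_def by (auto intro!: derivative_eq_intros)
    have "((\<lambda>t. X (l t)) has_derivative (\<lambda>s. D (s *\<^sub>R w))) (at 0)"
      by (rule has_derivative_compose[OF l]) (simp add: l_def X)
    then have dv: "((\<lambda>t. X (l t)) has_vector_derivative D w) (at 0)"
      using lin by (simp add: has_vector_derivative_def linear_scale)
    have di: "((\<lambda>t. X (l t) $ i) has_real_derivative D w $ i) (at 0)" for i
      unfolding has_real_derivative_iff_has_vector_derivative
      by (rule bounded_linear.has_vector_derivative[OF bounded_linear_vec_nth dv])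
    define Q where "Q i t = (X (l t) $ i - X (l 0) $ i) / t" for i t
    have Q: "(Q i \<longlongrightarrow> D w $ i) (at 0)" for i
      using di[of i] unfolding has_field_derivative_iff Q_def by simp
    have D12: "D w $ 1 = 0" "D w $ 2 = 0" using arg_cong[OF w, of "\<lambda>y. y $ 1"] arg_cong[OF w, of "\<lambda>y. y $ 2"] by simp_all
    have "isCont l 0" unfolding l_def by (intro continuous_intros)
    then have "filterlim l (nhds x0) (at 0)" by (simp add: isCont_def l_def)
    then have "\<forall>\<^sub>F t in at 0. l t \<in> interior V"
      by (rule eventually_compose_filterlim[OF eventually_nhds_in_open[OF open_interior x0]])
    \<comment> \<open>Dividing the Lipschitz bound by t controls the vertical difference quotient by
      the horizontal ones, which tend to 0 if \<open>pr (D w) = 0\<close>.\<close>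
    then have "\<forall>\<^sub>F t in at 0. \<bar>Q 3 t\<bar> \<le> L * (\<bar>Q 1 t\<bar> + \<bar>Q 2 t\<bar>)"
    proof eventually_elim
      case (elim t)
      let ?y = "X (l t)" and ?z = "X (l 0)"
      have "l t \<in> V" "l 0 \<in> V" using elim x0 interior_subset by (auto simp: l_def)
      then have m: "?y \<in> S" "?z \<in> S" using V by blast+
      have "norm (pr ?y - pr ?z) \<le> \<bar>?y $ 1 - ?z $ 1\<bar> + \<bar>?y $ 2 - ?z $ 2\<bar>"
        using norm_le_l1_cart[of "pr ?y - pr ?z"] by (simp add: sum_2)
      then have "L * norm (pr ?y - pr ?z) \<le> L * (\<bar>?y $ 1 - ?z $ 1\<bar> + \<bar>?y $ 2 - ?z $ 2\<bar>)"
        using L(1) by (intro mult_left_mono) auto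
      moreover have "\<bar>?y $ 3 - ?z $ 3\<bar> \<le> L * norm (pr ?y - pr ?z)"
        using L(2)[OF m] L(2)[OF m(2,1)] by (simp add: norm_minus_commute abs_le_iff)
      ultimately have "\<bar>?y $ 3 - ?z $ 3\<bar> \<le> L * (\<bar>?y $ 1 - ?z $ 1\<bar> + \<bar>?y $ 2 - ?z $ 2\<bar>)" by linarith
      then have "\<bar>?y $ 3 - ?z $ 3\<bar> / \<bar>t\<bar> \<le> L * (\<bar>?y $ 1 - ?z $ 1\<bar> + \<bar>?y $ 2 - ?z $ 2\<bar>) / \<bar>t\<bar>"
        by (rule divide_right_mono) simp
      then show ?case by (simp add: Q_def abs_divide add_divide_distrib distrib_left)
    qed
    then have "\<bar>D w $ 3\<bar> \<le> L * (\<bar>D w $ 1\<bar> + \<bar>D w $ 2\<bar>)"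
      by (intro tendsto_le[OF _ _ _ \<open>\<forall>\<^sub>F t in at 0. \<bar>Q 3 t\<bar> \<le> L * (\<bar>Q 1 t\<bar> + \<bar>Q 2 t\<bar>)\<close>] tendsto_intros Q) auto
    then have "D w = 0" using D12 by (simp add: vec_eq_iff forall_3)
    then show ?thesis using D lin linear_injective_0 by blast
  qed
  moreover have "linear (\<lambda>w. pr (D w))"
    using linear_compose[OF lin linear_pr] by (simp add: o_def)
  ultimately show ?thesis using linear_injective_0 by blast
qed

text \<open>Without vertical tangent vectors the projected parametrization has an invertible
  derivative at the point, and the open mapping theorem used asks for a right inverse there only.
  \<open>W\<close> is arbitrary so that each sheet can be treated separately.\<close>

lemma pr_open_at_interior:
  assumes p: "p \<in> topspace M - B" and W: "openin M W" "p \<in> W"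
  shows "pr (\<phi> p) \<in> interior (pr ` \<phi> ` W)"
proof -
  obtain U h where Uh: "(U, h) \<in> A" "p \<in> U" "h p $ 2 > 0" using interior_chart[OF p] by blast
  define X where "X = \<phi> \<circ> inv_into U h"
  note ch = chartD[OF Uh(1), folded X_def]
  note cf = chart_facts[OF ch(1)]
  define V where "V = h ` (U \<inter> W)"
  have x0: "h p \<in> interior V"
    unfolding V_def using half_plane_interior[OF cf(5)[OF W(1)]] Uh W by blast
  have x0U: "h p \<in> interior (h ` U)"
    using x0 interior_mono[of V "h ` U"] by (auto simp: V_def)
  obtain r g where r: "r > 0" "\<And>k. Ck_on k (ball (h p) r) g"
    "\<And>x. x \<in> h ` U \<inter> ball (h p) r \<Longrightarrow> X x = g x"
    using smooth_on_extension[OF ch(3), of "h p"] Uh by blast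
  define D where "D = frechet_derivative g (at (h p))"
  have "(g has_derivative D) (at (h p))"
    unfolding D_def using Ck_on_first[OF r(2)[of "Suc 0"], of "h p"] r(1) by simp
  note ext = half_plane_derivative_extension[OF cf(2) _ r(3) r(1) this]
  have XD: "(X has_derivative D) (at (h p))"
    using ext(1) Uh at_within_interior[OF x0U] by simp
  have "inj D" using ext(2) ch(4)[of "h p"] Uh by simp
  have XV: "X ` V \<subseteq> \<phi> ` W" using ch(5) by (auto simp: V_def)
  have "\<phi> ` W \<subseteq> S" using openin_subset[OF W(1)] by blast
  then have inj: "inj (\<lambda>w. pr (D w))"
    using nonvertical[OF x0 XD \<open>inj D\<close>] XV by blast
  have lin: "linear (\<lambda>w. pr (D w))"
    using linear_compose[OF has_derivative_linear[OF XD] linear_pr] by (simp add: o_def)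
  have "surj (\<lambda>w. pr (D w))" using linear_inj_imp_surj[OF lin inj] .
  then obtain g' where g': "linear g'" "(\<lambda>w. pr (D w)) \<circ> g' = id"
    using linear_surjective_right_inverse[OF lin] by blast
  have "continuous_on (interior V) (\<lambda>x. pr (X x))"
    using interior_subset[of V]
    by (intro continuous_on_pr continuous_on_subset[OF smooth_on_imp_continuous_on[OF ch(3)]])
       (auto simp: V_def)
  moreover have "((\<lambda>x. pr (X x)) has_derivative (\<lambda>w. pr (D w))) (at (h p))"
    by (rule bounded_linear.has_derivative[OF bounded_linear_pr XD])
  ultimately have "pr (X (h p)) \<in> interior ((\<lambda>x. pr (X x)) ` interior V)"
    using g' x0 by (intro sussmann_open_mapping[of "interior V" _ "h p" "\<lambda>w. pr (D w)" g'])
      (auto simp: linear_conv_bounded_linear)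
  moreover have "pr ` X ` interior V \<subseteq> pr ` \<phi> ` W"
    by (rule image_mono[OF order_trans[OF image_mono[OF interior_subset] XV]])
  ultimately show ?thesis
    using interior_mono[of "pr ` X ` interior V" "pr ` \<phi> ` W"] ch(5)[OF Uh(2)]
    unfolding image_image by (metis subsetD)
qed

text \<open>The projection of the part off \<open>\<Gamma>\<close> is open, and relatively closed in
  \<open>\<Omega>\<close> because \<open>S\<close> is compact and \<open>\<Gamma>\<close> projects
  outside \<open>\<Omega>\<close>. Connectedness makes it all of \<open>\<Omega>\<close>.\<close>

lemma pr_image: "pr ` S = \<Omega> \<union> pr ` \<Gamma>"
proof -
  let ?I = "pr ` (S - \<Gamma>)"
  have sub: "?I \<subseteq> \<Omega>" using sms_set_pr(1)[OF sms_set_S] by (rule image_subsetI)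
  have \<Gamma>S: "\<Gamma> \<subseteq> S" using boundary_bij by blast
  have IS: "?I = pr ` S \<inter> \<Omega>" using sub \<Gamma>_pr by blast
  have "open ?I"
  proof (subst open_subopen, rule ballI)
    fix q assume q: "q \<in> ?I"
    obtain p where p: "p \<in> topspace M - B" "q = pr (\<phi> p)"
      using q boundary_bij by blast
    \<comment> \<open>Restricting to heights above \<open>c\<close> keeps the image off
      \<open>\<Gamma>\<close>, so the neighbourhood found lies in \<open>?I\<close>.\<close>
    let ?W = "{p \<in> topspace M. \<phi> p \<in> {y. y $ 3 > c}}"
    have "open {y :: real^3. y $ 3 > c}" by (intro open_Collect_less continuous_intros)
    then have W: "openin M ?W"
      by (intro openin_continuous_map_preimage[OF continuous_\<phi>]) simp
    have "\<phi> p \<in> S - \<Gamma>" using p boundary_iff by blast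
    then have "p \<in> ?W" using sms_set_pr(2)[OF sms_set_S] p by blast
    then have "q \<in> interior (pr ` \<phi> ` ?W)" using pr_open_at_interior[OF p(1) W] p(2) by simp
    moreover have "pr ` \<phi> ` ?W \<subseteq> ?I" using \<Gamma>(2) by force
    ultimately show "\<exists>T. open T \<and> q \<in> T \<and> T \<subseteq> ?I"
      by (meson interior_subset open_interior subset_trans)
  qed
  moreover have "open (\<Omega> - ?I)"
  proof -
    have "compact (pr ` S)"
      using sms_set_S by (intro compact_continuous_image continuous_intros) (simp add: sms_set_def)
    then have "open (\<Omega> - pr ` S)" using \<Omega>_open by (intro open_Diff compact_imp_closed)
    moreover have "\<Omega> - ?I = \<Omega> - pr ` S" using IS by blast
    ultimately show ?thesis by simp
  qed
  ultimately have "\<Omega> - ?I = {} \<or> ?I = {}"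
    using convex_connected[OF \<Omega>(1)] sub connectedD[of \<Omega> ?I "\<Omega> - ?I"] by blast
  then have "?I = \<Omega>" using interior_nonempty sub by blast
  then show ?thesis using \<Gamma>S by blast
qed

text \<open>Disjoint neighbourhoods of two points with equal image both project onto a neighbourhood
  of the common projection, and unique heights make every point there a projected double point. The
  projected double points are thus open and compact in the plane, hence empty.\<close>

lemma injective: "inj_on \<phi> (topspace M)"
proof -
  let ?MM = "prod_topology M M"
  \<comment> \<open>Among pairs with equal image, the squares of injectivity domains remove exactly
    the diagonal and leave a closed set.\<close>
  define E where "E = {z \<in> topspace ?MM. \<phi> (fst z) = \<phi> (snd z)} - \<Union> {W \<times> W | W. openin M W \<and> inj_on \<phi> W}"
  have E: "(p, p') \<in> E \<longleftrightarrow> p \<in> topspace M \<and> p' \<in> topspace M \<and> \<phi> p = \<phi> p' \<and> p \<noteq> p'" for p p'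
  proof -
    have "(\<exists>W. openin M W \<and> inj_on \<phi> W \<and> p \<in> W \<and> p' \<in> W) \<longleftrightarrow> p = p'"
      if "p \<in> topspace M" "\<phi> p = \<phi> p'"
      using that locally_injective[of p] by (metis inj_onD)
    then show ?thesis unfolding E_def by auto
  qed
  have cf: "continuous_map ?MM euclidean (\<phi> \<circ> fst)" "continuous_map ?MM euclidean (\<phi> \<circ> snd)"
    by (rule continuous_map_compose[OF _ continuous_\<phi>], rule continuous_map_fst continuous_map_snd)+
  have "closedin ?MM {z \<in> topspace ?MM. (\<phi> \<circ> fst) z = (\<phi> \<circ> snd) z}"
    by (rule closedin_continuous_maps_eq[OF _ cf]) simp
  then have "closedin ?MM E"
    unfolding E_def o_def by (intro closedin_diff openin_Union) (auto simp: openin_prod_Times_iff)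
  then have "compactin ?MM E"
    using compact_M by (intro closedin_compact_space) (simp add: compact_space_prod_topology)
  moreover define F where "F = (\<lambda>z. pr (\<phi> (fst z))) ` E"
  have "continuous_map ?MM euclidean (pr \<circ> (\<phi> \<circ> fst))"
    by (rule continuous_map_compose[OF cf(1)]) (simp add: continuous_on_pr)
  ultimately have F: "compact F"
    using image_compactin[of ?MM E euclidean "pr \<circ> (\<phi> \<circ> fst)"] by (simp add: F_def o_def)
  have "open F"
  proof (subst open_subopen, rule ballI)
    fix q assume "q \<in> F"
    then obtain p p' where pp: "(p, p') \<in> E" "q = pr (\<phi> p)" by (auto simp: F_def)
    then have p: "p \<in> topspace M" "p' \<in> topspace M" "\<phi> p = \<phi> p'" "p \<noteq> p'" using E by auto
    \<comment> \<open>As the images agree, by \<open>boundary_iff\<close> both points or neither lie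
      in \<open>B\<close>, on which \<open>\<phi>\<close> is injective.\<close>
    have "p \<notin> B" "p' \<notin> B" using p boundary_iff boundary_bij(3) by (metis inj_onD)+
    obtain W W' where W: "openin M W" "openin M W'" "p \<in> W" "p' \<in> W'" "disjnt W W'"
      using Hausdorff_M p unfolding Hausdorff_space_def by metis
    let ?O = "interior (pr ` \<phi> ` W) \<inter> interior (pr ` \<phi> ` W')"
    have "q \<in> ?O"
      using pr_open_at_interior[of p W] pr_open_at_interior[of p' W'] W p pp \<open>p \<notin> B\<close> \<open>p' \<notin> B\<close> by auto
    moreover have "?O \<subseteq> F"
    proof
      fix x assume "x \<in> ?O"
      then have "x \<in> pr ` \<phi> ` W" "x \<in> pr ` \<phi> ` W'" using interior_subset by blast+
      then obtain a b where ab: "a \<in> W" "b \<in> W'" "x = pr (\<phi> a)" "x = pr (\<phi> b)" by blast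
      then have abM: "a \<in> topspace M" "b \<in> topspace M" using W openin_subset by blast+
      then have "\<phi> a = \<phi> b" using sms_set_unique_height[OF sms_set_S sms_set_S] ab by auto
      moreover have "a \<noteq> b" using ab W by (auto simp: disjnt_iff)
      ultimately have "(a, b) \<in> E" using E abM by blast
      then show "x \<in> F" unfolding F_def using ab(3) by force
    qed
    ultimately show "\<exists>T. open T \<and> q \<in> T \<and> T \<subseteq> F"
      using open_Int[OF open_interior open_interior] by (intro exI[of _ ?O] conjI)
  qed
  with F have "F = {} \<or> F = UNIV" using clopen compact_imp_closed by blast
  then have "F = {}" using F compact_imp_bounded not_bounded_UNIV by blast
  then have "E = {}" by (simp add: F_def)
  then show ?thesis unfolding inj_on_def using E by blast
qed

end

section \<open>Rotations and graphs\<close>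

text \<open>The curves are carried along. As \<open>R\<close> is orthogonal and fixes the vertical
  axis, it preserves heights, the third component of the normal and the normal parts of
  accelerations.\<close>

lemma sms_at_rotation:
  assumes S: "sms_at \<alpha> S y" and R: "orthogonal_transformation R" "R (axis 3 1) = axis 3 1"
  shows "sms_at \<alpha> ((\<lambda>p. b + R (p - b)) ` S) (b + R (y - b))"
proof -
  obtain N acc where N: "norm N = 1"
    and cur: "\<And>\<tau>. \<tau> \<bullet> N = 0 \<Longrightarrow> \<exists>\<gamma>. jet2 \<gamma> \<tau> (acc \<tau>) \<and> \<gamma> 0 = y \<and> (\<forall>\<^sub>F t in nhds 0. \<gamma> t \<in> S)"
    and tr: "\<And>a b. orthonormal_pair N a b \<Longrightarrow> (acc a + acc b) \<bullet> N = \<alpha> * N $ 3 / y $ 3"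
    using S unfolding sms_at_def by blast
  have inner: "R u \<bullet> R v = u \<bullet> v" for u v using R(1) by (simp add: orthogonal_transformation_def)
  have lin: "linear R" using R(1) by (rule orthogonal_transformation_linear)
  have bl: "bounded_linear R" using lin by (simp add: linear_conv_bounded_linear)
  have R3: "R u $ 3 = u $ 3" for u using inner[of u "axis 3 1"] R(2) by (simp add: inner_axis3)
  define R' where "R' = inv R"
  have RR': "R (R' u) = u" for u
    unfolding R'_def using orthogonal_transformation_surj[OF R(1)] by (rule surj_f_inv_f)
  have perp: "R' u \<bullet> v = u \<bullet> R v" for u v using inner[of "R' u" v] RR' by simp
  have norm': "norm (R' u) = norm u" for u
    using orthogonal_transformation_norm[OF R(1), of "R' u"] RR' by simp
  have inner': "R' u \<bullet> R' v = u \<bullet> v" for u v using inner[of "R' u" "R' v"] RR' by simp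
  show ?thesis
    unfolding sms_at_def
  proof (intro exI[of _ "R N"] exI[of _ "\<lambda>\<tau>. R (acc (R' \<tau>))"] conjI allI impI)
    show "norm (R N) = 1" using orthogonal_transformation_norm[OF R(1)] N by simp
  next
    fix \<tau> assume "\<tau> \<bullet> R N = 0"
    then have "R' \<tau> \<bullet> N = 0" using perp by simp
    then obtain \<gamma> where \<gamma>: "jet2 \<gamma> (R' \<tau>) (acc (R' \<tau>))" "\<gamma> 0 = y" "\<forall>\<^sub>F t in nhds 0. \<gamma> t \<in> S"
      using cur by blast
    have "jet2 (\<lambda>t. b + R (\<gamma> t - b)) \<tau> (R (acc (R' \<tau>)))"
      using jet2_add[OF jet2_const jet2_bounded_linear[OF bl jet2_diff[OF \<gamma>(1) jet2_const]], of b b]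
      by (simp add: RR')
    moreover have "\<forall>\<^sub>F t in nhds 0. b + R (\<gamma> t - b) \<in> (\<lambda>p. b + R (p - b)) ` S"
      using \<gamma>(3) by eventually_elim (rule imageI)
    ultimately show "\<exists>\<gamma>. jet2 \<gamma> \<tau> (R (acc (R' \<tau>))) \<and> \<gamma> 0 = b + R (y - b) \<and>
        (\<forall>\<^sub>F t in nhds 0. \<gamma> t \<in> (\<lambda>p. b + R (p - b)) ` S)"
      using \<gamma>(2) by blast
  next
    fix u v assume "orthonormal_pair (R N) u v"
    then have "orthonormal_pair N (R' u) (R' v)"
      by (simp add: orthonormal_pair_def perp norm' RR')
    from tr[OF this] show "(R (acc (R' u)) + R (acc (R' v))) \<bullet> R N = \<alpha> * R N $ 3 / (b + R (y - b)) $ 3"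
      by (simp add: R3 inner inner_add_left)
  qed
qed

lemma (in convex_boundary) sms_set_rotation:
  assumes T: "sms_set T" and R: "orthogonal_transformation R" "R (axis 3 1) = axis 3 1"
    and inv: "(\<lambda>p. b + R (p - b)) ` \<Gamma> = \<Gamma>"
  shows "sms_set ((\<lambda>p. b + R (p - b)) ` T)"
  unfolding sms_set_def
proof (intro conjI ballI)
  let ?f = "\<lambda>p. b + R (p - b)"
  have R3: "R u $ 3 = u $ 3" for u
    using R by (metis inner_axis3(1) orthogonal_transformation_def)
  have "linear R" using R(1) by (rule orthogonal_transformation_linear)
  then have "continuous_on T (\<lambda>p. R (p - b))"
    by (intro linear_continuous_on_compose[of _ _ R] continuous_intros)
  then show "compact (?f ` T)"
    using T unfolding sms_set_def by (intro compact_continuous_image continuous_intros) simp_all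
  have "?f ` \<Gamma> \<subseteq> ?f ` T" using T unfolding sms_set_def by (intro image_mono) simp
  then show "\<Gamma> \<subseteq> ?f ` T" using inv by simp
  show "y $ 3 > 0" if "y \<in> ?f ` T" for y using that T by (auto simp: sms_set_def R3)
  fix y assume y: "y \<in> ?f ` T - \<Gamma>"
  then obtain x where x: "x \<in> T" "y = ?f x" by blast
  then have "x \<notin> \<Gamma>" using y inv by blast
  then show "sms_at \<alpha> (?f ` T) y"
    using sms_at_rotation[OF _ R, of \<alpha> T x b] x T by (simp add: sms_set_def)
qed

text \<open>Off \<open>\<Gamma>\<close>, any competitor projects into \<open>\<Omega>\<close>, which
  \<open>S\<close> covers, and equal projections force equal points. For a rotated copy this is one
  inclusion; the inverse rotation gives the other.\<close>

lemma (in compact_sms) sms_set_subset: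
  assumes "sms_set T"
  shows "T \<subseteq> S"
proof
  fix y assume y: "y \<in> T"
  show "y \<in> S"
  proof (cases "y \<in> \<Gamma>")
    case True
    then show ?thesis using boundary_bij by blast
  next
    case False
    then have "pr y \<in> pr ` S" using sms_set_pr(1)[OF assms] y pr_image by blast
    then obtain z where "z \<in> S" "pr z = pr y" by (metis imageE)
    then show ?thesis using sms_set_unique_height[OF sms_set_S assms _ y, of z] by simp
  qed
qed

lemma (in compact_sms) surface_of_revolution_S:
  assumes \<Gamma>: "\<Gamma> = {p. p $ 3 = c \<and> dist b p = r}" and b: "b $ 3 = c"
  shows "surface_of_revolution S"
proof -
  have sub: "(\<lambda>p. b + R (p - b)) ` X \<subseteq> X"
    if R: "orthogonal_transformation R" "R (axis 3 1) = axis 3 1" and X: "X = S \<or> X = \<Gamma>" for R X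
  proof -
    have G: "(\<lambda>p. b + R (p - b)) ` \<Gamma> \<subseteq> \<Gamma>"
      if R: "orthogonal_transformation R" "R (axis 3 1) = axis 3 1" for R
    proof -
      have "R u $ 3 = u $ 3" for u using R by (metis inner_axis3(1) orthogonal_transformation_def)
      then show ?thesis
        using orthogonal_transformation_norm[OF R(1)] b
        by (auto simp: \<Gamma> dist_norm norm_minus_commute)
    qed
    \<comment> \<open>The inverse of \<open>R\<close> satisfies the same conditions, which upgrades
      the inclusion for the circle to an equality.\<close>
    have inv: "orthogonal_transformation (inv R)" "inv R (axis 3 1) = axis 3 1" "\<And>u. R (inv R u) = u"
      using orthogonal_transformation_inv[OF R(1)] orthogonal_transformation_inj[OF R(1)]
        orthogonal_transformation_surj[OF R(1)] R(2)
      by (auto simp: surj_f_inv_f inv_f_eq)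
    have "(\<lambda>p. b + R (p - b)) ` \<Gamma> = \<Gamma>"
    proof
      show "\<Gamma> \<subseteq> (\<lambda>p. b + R (p - b)) ` \<Gamma>"
      proof
        fix x assume "x \<in> \<Gamma>"
        then have "b + inv R (x - b) \<in> \<Gamma>" using G[OF inv(1,2)] by blast
        moreover have "x = b + R ((b + inv R (x - b)) - b)" by (simp add: inv(3))
        ultimately show "x \<in> (\<lambda>p. b + R (p - b)) ` \<Gamma>" by blast
      qed
    qed (rule G[OF R])
    with sms_set_subset[OF sms_set_rotation[OF sms_set_S R this]] X show ?thesis by (elim disjE) simp_all
  qed
  have e3: "vec_a = axis 3 1" by (simp add: vec_a_def vec_eq_iff forall_3 axis_def)
  have "(\<lambda>p. b + Q *v (p - b)) ` S = S" if Q: "rotation_matrix Q" "Q *v vec_a = vec_a" for Q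
  proof
    have orth: "orthogonal_matrix Q" using Q(1) by (simp add: rotation_matrix_def)
    then have QQ: "Q ** transpose Q = mat 1" "transpose Q ** Q = mat 1"
      by (simp_all add: orthogonal_matrix_def)
    have ot: "orthogonal_transformation ((*v) Q)"
      "orthogonal_transformation ((*v) (transpose Q))"
      using orth by (simp_all add: orthogonal_transformation_matrix)
    have fix': "transpose Q *v axis 3 1 = axis 3 1"
      using Q(2) QQ(2) unfolding e3 by (metis matrix_vector_mul_assoc matrix_vector_mul_lid)
    show "(\<lambda>p. b + Q *v (p - b)) ` S \<subseteq> S"
      by (rule sub[OF ot(1)]) (use Q(2) e3 in auto)
    show "S \<subseteq> (\<lambda>p. b + Q *v (p - b)) ` S"
    proof
      fix x assume "x \<in> S"
      then have "b + transpose Q *v (x - b) \<in> S" using sub[OF ot(2) fix', of S] by blast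
      moreover have "x = b + Q *v ((b + transpose Q *v (x - b)) - b)"
        by (simp only: add_diff_cancel_left' matrix_vector_mul_assoc QQ matrix_vector_mul_lid)
          simp
      ultimately show "x \<in> (\<lambda>p. b + Q *v (p - b)) ` S" by blast
    qed
  qed
  moreover have "vec_a \<noteq> 0" by (simp add: e3)
  ultimately show ?thesis unfolding surface_of_revolution_def by blast
qed

lemma (in compact_sms) graph_on_S:
  assumes P: "P = {p. p $ 3 = c}"
    and \<Omega>': "\<Omega>' \<noteq> {}" "openin (top_of_set P) \<Omega>'" "convex \<Omega>'" "pr ` \<Omega>' = \<Omega>"
    and \<Gamma>': "\<Gamma> = closure \<Omega>' - \<Omega>'"
  shows "graph_on P M \<phi>"
  unfolding graph_on_def
proof (intro conjI exI)
  show "inj_on \<phi> (topspace M)" by (rule injective)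
  let ?D = "\<Omega>' \<union> \<Gamma>"
  have \<Omega>P: "\<Omega>' \<subseteq> P" using openin_imp_subset[OF \<Omega>'(2)] .
  have \<Gamma>P: "\<Gamma> \<subseteq> P" using \<Gamma>(2) P by blast
  show "domain_in P ?D"
    unfolding domain_in_def
  proof (intro conjI exI)
    show "\<Omega>' \<union> \<Gamma> \<subseteq> P" using \<Omega>P \<Gamma>P by blast
    show "\<Omega>' \<union> \<Gamma> \<subseteq> closure \<Omega>'" using \<Gamma>' closure_subset by blast
    show "connected \<Omega>'" by (rule convex_connected[OF \<Omega>'(3)])
  qed (use \<Omega>' in auto)
  \<comment> \<open>\<open>Y q\<close> picks the point of \<open>S\<close> above \<open>q\<close>,
    unique by comparison; \<open>u\<close> subtracts \<open>c\<close>, the height of the plane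
    itself.\<close>
  define Y where "Y q = (SOME y. y \<in> S \<and> pr y = pr q)" for q
  define u where "u q = Y q $ 3 - c" for q
  have a: "pr (q + t *\<^sub>R vec_a) = pr q" "(q + t *\<^sub>R vec_a) $ 3 = q $ 3 + t" for q t
    by (simp_all add: vec_a_def vec_eq_iff forall_2)
  have prS: "pr ` S = pr ` ?D" using pr_image \<Omega>'(4) by auto
  have Y: "Y q \<in> S \<and> pr (Y q) = pr q" if "pr q \<in> pr ` S" for q
  proof -
    have "\<exists>y. y \<in> S \<and> pr y = pr q" using that by (metis imageE)
    then show ?thesis unfolding Y_def by (rule someI_ex)
  qed
  have lift: "q + u q *\<^sub>R vec_a = Y q" if "q \<in> ?D" for q
  proof (rule pr_eqI)
    have "pr q \<in> pr ` S" using that prS by blast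
    then show "pr (q + u q *\<^sub>R vec_a) = pr (Y q)" using Y a by simp
    have "q $ 3 = c" using that \<Omega>P \<Gamma>P P by blast
    then show "(q + u q *\<^sub>R vec_a) $ 3 = Y q $ 3" by (simp add: a(2) u_def del: vector_add_component)
  qed
  have "S = Y ` ?D"
  proof
    show "Y ` ?D \<subseteq> S" using Y prS by blast
    show "S \<subseteq> Y ` ?D"
    proof
      fix y assume y: "y \<in> S"
      then have "pr y \<in> pr ` ?D" using prS by blast
      then obtain q where q: "q \<in> ?D" "pr y = pr q" by (metis imageE)
      have "Y q \<in> S" "pr (Y q) = pr q" using Y[of q] q prS by blast+
      then have "y = Y q" using sms_set_unique_height[OF sms_set_S sms_set_S y] q(2) by simp
      then show "y \<in> Y ` ?D" using q(1) by blast
    qed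
  qed
  also have "Y ` ?D = {q + u q *\<^sub>R vec_a | q. q \<in> ?D}" using lift by force
  finally show "S = {q + u q *\<^sub>R vec_a | q. q \<in> ?D}" .
qed

theorem proposition5p6:
  fixes \<alpha> :: real and M :: "'a topology" and A :: "('a set \<times> ('a \<Rightarrow> real^2)) set"
    and \<phi> :: "'a \<Rightarrow> real^3" and P \<Gamma> :: "(real^3) set"
  assumes "\<alpha> < 0"
    and "horizontal_plane P"
    and "\<Gamma> \<subseteq> P" and "\<Gamma> \<subseteq> upper_half_space"
    and "simple_closed_curve \<Gamma>" and "convex_curve_in P \<Gamma>"
    and "singular_minimal_surface \<alpha> M A \<phi>"
    and "compact_space M"
    and "has_boundary M A \<phi> \<Gamma>"
  shows "graph_on P M \<phi> \<and>
         (circle_in P \<Gamma> \<longrightarrow> surface_of_revolution (\<phi> ` topspace M))"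
proof -
  obtain c where P: "P = {p. p $ 3 = c}"
    using assms(2) by (auto simp: horizontal_plane_def inner_vec_a)
  obtain \<Omega>' where \<Omega>': "\<Omega>' \<noteq> {}" "openin (top_of_set P) \<Omega>'" "convex \<Omega>'" "\<Gamma> = closure \<Omega>' - \<Omega>'"
    using assms(6) unfolding convex_curve_in_def by blast
  have \<Gamma>0: "\<Gamma> \<noteq> {}" using assms(5) by (auto simp: simple_closed_curve_def)
  have \<Omega>P: "\<Omega>' \<subseteq> P" using openin_imp_subset[OF \<Omega>'(2)] .
  \<comment> \<open>Relative openness in \<open>P\<close> becomes openness in two dimensions,
    because q \<mapsto> lift q + c a is a continuous inverse of \<open>pr\<close> on
    \<open>P\<close>.\<close>
  have open\<Omega>: "open (pr ` \<Omega>')"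
  proof -
    obtain T where T: "open T" "\<Omega>' = P \<inter> T" using \<Omega>'(2) by (auto simp: openin_open)
    have l: "pr (lift q + c *\<^sub>R vec_a) = q" "(lift q + c *\<^sub>R vec_a) $ 3 = c" for q
      by (simp_all add: vec_a_def vec_eq_iff forall_2)
    have "pr ` \<Omega>' = (\<lambda>q. lift q + c *\<^sub>R vec_a) -` T"
    proof (intro equalityI subsetI)
      fix q assume "q \<in> pr ` \<Omega>'"
      then obtain x where x: "x \<in> \<Omega>'" "q = pr x" by blast
      then have "lift q + c *\<^sub>R vec_a = x" using l[of q] \<Omega>P P by (intro pr_eqI) auto
      then show "q \<in> (\<lambda>q. lift q + c *\<^sub>R vec_a) -` T" using x T by simp
    next
      fix q assume "q \<in> (\<lambda>q. lift q + c *\<^sub>R vec_a) -` T"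
      then have "lift q + c *\<^sub>R vec_a \<in> \<Omega>'" using T P l(2) by simp
      then show "q \<in> pr ` \<Omega>'" using l(1) by (metis imageI)
    qed
    moreover have "linear lift" by (rule linearI) (simp_all add: vec_eq_iff forall_3)
    then have "continuous_on UNIV (\<lambda>q. lift q + c *\<^sub>R vec_a)"
      by (intro continuous_intros linear_continuous_on) (simp add: linear_conv_bounded_linear)
    ultimately show ?thesis using T(1) by (simp add: open_vimage)
  qed
  have \<Gamma>cl: "pr b \<in> closure (pr ` \<Omega>') - pr ` \<Omega>'" if b: "b \<in> \<Gamma>" for b
  proof
    show "pr b \<in> closure (pr ` \<Omega>')"
      using closure_bounded_linear_image_subset[OF bounded_linear_pr, of \<Omega>'] b \<Omega>'(4) by blast
    show "pr b \<notin> pr ` \<Omega>'"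
    proof
      assume "pr b \<in> pr ` \<Omega>'"
      then obtain x where x: "x \<in> \<Omega>'" "pr b = pr x" by blast
      then have "b = x" using b assms(3) \<Omega>P P by (intro pr_eqI) auto
      then show False using b x \<Omega>'(4) by blast
    qed
  qed
  have c: "c > 0" using \<Gamma>0 assms(3,4) P by (auto simp: upper_half_space_def)
  have conv: "convex (pr ` \<Omega>')" by (rule convex_linear_image[OF linear_pr \<Omega>'(3)])
  have height: "b $ 3 = c" if "b \<in> \<Gamma>" for b using that assms(3) P by blast
  have "pr ` \<Omega>' \<noteq> {}" using \<Omega>'(1) by simp
  interpret compact_sms \<alpha> c "pr ` \<Omega>'" \<Gamma> M A \<phi>
    by unfold_locales fact+
  show ?thesis
  proof (intro conjI impI)
    show "graph_on P M \<phi>" by (rule graph_on_S[OF P \<Omega>'(1-3) refl \<Omega>'(4)])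
    assume "circle_in P \<Gamma>"
    then obtain b r where "b \<in> P" "\<Gamma> = {p \<in> P. dist b p = r}" unfolding circle_in_def by blast
    then show "surface_of_revolution S" using surface_of_revolution_S[of b r] P by simp
  qed
qed

end
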